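(* Let $D$ and $D_*$ be simply connected hyperbolic domains in $\mathbb{R}^2\cong\mathbb{C}$ with non-empty boundary, and let $f$ be a Euclidean harmonic univalent (injective) mapping of $D$ onto $D_*$. Write $d(z)=\operatorname{dist}(z,\partial D)$ for $z\in D$ and $d_*(w)=\operatorname{dist}(w,\partial D_* )$ for $w\in D_*$. Then: (iii.1) There is a constant $c>0$ such that $d(z)\,\Lambda_f(z)\ge c\, d_*(f(z))$ for all $z\in D$. (iii.2) If in addition $D$ is a $C^{1,\alpha}$ domain for some $0<\alpha<1$ and $D_*$ is a bounded convex domain, then there is a constant $c>0$ such that $\Lambda_f(z)\ge c$ for all $z\in D$.
   Context: A Euclidean harmonic mapping is a complex-valued function whose real and imaginary parts are harmonic. For a differentiable planar map $f$, $\Lambda_f(z)=\max_{|h|=1}|f'(z)h|=|\partial f(z)|+|\overline{\partial} f(z)|$, where $f'(z)$ is the real differential, $\partial f=\frac12(f_x-if_y)$ and $\overline\partial f=\frac12(f_x+if_y)$. A simply connected planar domain is hyperbolic if it is different from $\mathbb{C}$. A $C^{1,\alpha}$ domain is the interior $\mathrm{Int}(\Gamma)$ of a Jordan curve $\Gamma$ of class $C^{1,\alpha}$. The constants may depend on the domains and the map. *)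

theory Defs
  imports "HOL-Analysis.Analysis"
begin

text \<open>Partial derivatives of a planar map in the real coordinates \<open>x\<close> and \<open>y\<close> of
  \<open>z = x + \<i> y\<close>.\<close>

definition partial_x :: "(complex \<Rightarrow> 'a::real_normed_vector) \<Rightarrow> complex \<Rightarrow> 'a" where
  "partial_x f z = frechet_derivative f (at z) 1"

definition partial_y :: "(complex \<Rightarrow> 'a::real_normed_vector) \<Rightarrow> complex \<Rightarrow> 'a" where
  "partial_y f z = frechet_derivative f (at z) \<i>"

text \<open>The next three notions are meant for open \<open>S\<close>.\<close>

definition C1_on :: "(complex \<Rightarrow> 'a::real_normed_vector) \<Rightarrow> complex set \<Rightarrow> bool" where
  "C1_on f S \<longleftrightarrow> (\<forall>z\<in>S. f differentiable (at z)) \<and>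
     continuous_on S (partial_x f) \<and> continuous_on S (partial_y f)"

definition C2_on :: "(complex \<Rightarrow> 'a::real_normed_vector) \<Rightarrow> complex set \<Rightarrow> bool" where
  "C2_on f S \<longleftrightarrow> C1_on f S \<and> C1_on (partial_x f) S \<and> C1_on (partial_y f) S"

definition harmonic_on :: "(complex \<Rightarrow> real) \<Rightarrow> complex set \<Rightarrow> bool" where
  "harmonic_on u S \<longleftrightarrow> C2_on u S \<and>
     (\<forall>z\<in>S. partial_x (partial_x u) z + partial_y (partial_y u) z = 0)"

definition harmonic_mapping_on :: "(complex \<Rightarrow> complex) \<Rightarrow> complex set \<Rightarrow> bool" where
  "harmonic_mapping_on f S \<longleftrightarrow>
     harmonic_on (\<lambda>z. Re (f z)) S \<and> harmonic_on (\<lambda>z. Im (f z)) S"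

definition Lambda :: "(complex \<Rightarrow> complex) \<Rightarrow> complex \<Rightarrow> real" where
  "Lambda f z = (SUP h\<in>sphere 0 1. norm (frechet_derivative f (at z) h))"

definition d_z :: "(complex \<Rightarrow> complex) \<Rightarrow> complex \<Rightarrow> complex" where
  "d_z f z = (partial_x f z - \<i> * partial_y f z) / 2"

definition d_zbar :: "(complex \<Rightarrow> complex) \<Rightarrow> complex \<Rightarrow> complex" where
  "d_zbar f z = (partial_x f z + \<i> * partial_y f z) / 2"

lemma frechet_derivative_wirtinger:
  assumes "f differentiable (at z)"
  shows "frechet_derivative f (at z) h = d_z f z * h + d_zbar f z * cnj h"
proof -
  interpret L: linear "frechet_derivative f (at z)"
    using assms by (rule linear_frechet_derivative)
  have "h = Re h *\<^sub>R 1 + Im h *\<^sub>R \<i>"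
    by (simp add: complex_eq_iff)
  then have "frechet_derivative f (at z) h = Re h *\<^sub>R partial_x f z + Im h *\<^sub>R partial_y f z"
    unfolding partial_x_def partial_y_def by (metis L.add L.scaleR)
  then show ?thesis
    by (simp add: d_z_def d_zbar_def complex_eq_iff field_simps)
qed

lemma max_norm_unit:
  fixes a b :: complex
  obtains h where "norm h = 1" "norm (a * h + b * cnj h) = norm a + norm b"
proof
  define h where "h = cis ((Arg b - Arg a) / 2)"
  show "norm h = 1" by (simp add: h_def)
  have e: "a = norm a * cis (Arg a)" "b = norm b * cis (Arg b)"
    by (metis rcis_cmod_Arg rcis_def)+
  have "a * h = norm a * cis ((Arg a + Arg b) / 2)"
    by (subst e(1)) (simp add: h_def cis_mult field_simps)
  moreover have "b * cnj h = norm b * cis ((Arg a + Arg b) / 2)"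
    by (subst e(2)) (simp add: h_def cis_cnj cis_mult field_simps)
  ultimately have "a * h + b * cnj h = of_real (norm a + norm b) * cis ((Arg a + Arg b) / 2)"
    by (simp add: algebra_simps)
  then show "norm (a * h + b * cnj h) = norm a + norm b"
    by (simp only: norm_mult norm_of_real norm_cis) simp
qed

text \<open>The supremum in \<^const>\<open>Lambda\<close> is a maximum, with the usual value.\<close>

lemma Lambda_eq:
  assumes "f differentiable (at z)"
  shows "Lambda f z = norm (d_z f z) + norm (d_zbar f z)"
    and "\<exists>h. norm h = 1 \<and> Lambda f z = norm (frechet_derivative f (at z) h)"
proof -
  obtain h where h: "norm h = 1"
    "norm (d_z f z * h + d_zbar f z * cnj h) = norm (d_z f z) + norm (d_zbar f z)"
    by (rule max_norm_unit)
  show eq: "Lambda f z = norm (d_z f z) + norm (d_zbar f z)"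
    unfolding Lambda_def
  proof (rule cSup_eq_maximum)
    show "norm (d_z f z) + norm (d_zbar f z)
        \<in> (\<lambda>h. norm (frechet_derivative f (at z) h)) ` sphere 0 1"
      using h by (intro image_eqI[of _ _ h]) (simp_all add: frechet_derivative_wirtinger[OF assms])
  next
    fix x assume "x \<in> (\<lambda>h. norm (frechet_derivative f (at z) h)) ` sphere 0 1"
    then obtain k where "norm k = 1" "x = norm (d_z f z * k + d_zbar f z * cnj k)"
      by (auto simp: frechet_derivative_wirtinger[OF assms])
    then show "x \<le> norm (d_z f z) + norm (d_zbar f z)"
      using norm_triangle_ineq[of "d_z f z * k" "d_zbar f z * cnj k"] by (simp add: norm_mult)
  qed
  show "\<exists>h. norm h = 1 \<and> Lambda f z = norm (frechet_derivative f (at z) h)"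
    using h eq by (auto simp: frechet_derivative_wirtinger[OF assms])
qed

definition hyperbolic_domain :: "complex set \<Rightarrow> bool" where
  "hyperbolic_domain D \<longleftrightarrow>
     open D \<and> connected D \<and> D \<noteq> {} \<and> simply_connected D \<and> D \<noteq> UNIV"

text \<open>A Jordan curve of class \<open>C\<^sup>1\<^sup>,\<^sup>\<alpha>\<close> is given by a regular closed
  parametrization, written as a \<open>1\<close>-periodic function on the line so that the derivatives also
  match at the base point.\<close>

definition C1_Hoelder_Jordan_curve :: "real \<Rightarrow> complex set \<Rightarrow> bool" where
  "C1_Hoelder_Jordan_curve \<alpha> \<Gamma> \<longleftrightarrow>
     (\<exists>(\<gamma> :: real \<Rightarrow> complex) \<gamma>' L.
        (\<forall>t. \<gamma> (t + 1) = \<gamma> t) \<and> simple_path \<gamma> \<and> path_image \<gamma> = \<Gamma> \<and>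
        (\<forall>t. (\<gamma> has_vector_derivative \<gamma>' t) (at t) \<and> \<gamma>' t \<noteq> 0) \<and>
        (\<forall>s t. norm (\<gamma>' s - \<gamma>' t) \<le> L * \<bar>s - t\<bar> powr \<alpha>))"

definition C1_Hoelder_domain :: "real \<Rightarrow> complex set \<Rightarrow> bool" where
  "C1_Hoelder_domain \<alpha> D \<longleftrightarrow> (\<exists>\<Gamma>. C1_Hoelder_Jordan_curve \<alpha> \<Gamma> \<and> D = inside \<Gamma>)"

end

theory Submission
  imports Defs "HOL-Complex_Analysis.Complex_Analysis"
begin

text \<open>
  On the simply connected \<open>D\<close> the map is \<open>f = h + cnj g\<close> with holomorphic \<open>h\<close> and \<open>g\<close>, and
  \<open>\<Lambda>\<^sub>f = |h'| + |g'|\<close>. By Lewy's theorem (\<open>Lewy\<close>) injectivity excludes \<open>|h'| = |g'|\<close>, so one of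
  the two derivatives dominates throughout \<open>D\<close>; up to conjugating \<open>f\<close> it is \<open>h'\<close>.

  First claim. Let \<open>R = d\<^sub>*(f z)\<close>. Since \<open>|df| \<le> 2 |h'| |dz|\<close>, a path in \<open>D\<close> from \<open>z\<close> whose
  \<open>|h'||dz|\<close>-length is less than \<open>R/2\<close> is mapped by \<open>f\<close> into a smaller disc about \<open>f z\<close>, hence stays in
  a compact part of \<open>D\<close>. Thus the local inverse of \<open>h\<close> at \<open>h z\<close> continues to the whole disc of
  radius \<open>R/2\<close> (\<open>inverse_branch_extends\<close>). It is a univalent map of that disc into \<open>D\<close>, has
  derivative \<open>1/h'(z)\<close> at the centre and omits every boundary point of \<open>D\<close>. The distortion theorem
  \<open>weak_Koebe\<close> bounds \<open>R/|h'(z)|\<close> by a constant times \<open>d(z)\<close>, which is the claim with an absolute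
  constant. This argument is a quantitative form of Rado's theorem that no harmonic
  homeomorphism maps the disc onto the plane.

  Second claim. By the first one it suffices that \<open>d\<^sub>*(f z) \<ge> c d(z)\<close>. Choose a supporting line of
  the convex \<open>D\<^sub>*\<close> at the boundary point nearest to \<open>f z\<close>. The distance of \<open>f\<close> to that line is a
  positive harmonic function on \<open>D\<close>; it is at least \<open>d\<^sub>* \<circ> f\<close> everywhere, with equality at \<open>z\<close>, so on a
  fixed compact set it is bounded below independently of \<open>z\<close>. The Hopf lemma \<open>cusp_Hopf\<close> turns
  this into linear growth along the inner normal at the point of \<open>\<partial>D\<close> nearest to \<open>z\<close>. For
  \<open>C\<^sup>1\<^sup>,\<^sup>\<alpha>\<close> boundaries no interior disc need touch that point, but the region
  \<open>Re w \<ge> M |w|\<^sup>1\<^sup>+\<^sup>\<alpha>\<close> in normal coordinates fits, and there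
  \<open>Re (w + A w\<^sup>1\<^sup>+\<^sup>\<alpha>)\<close> is an explicit barrier.
\<close>

section \<open>Harmonic maps on simply connected domains\<close>

lemma has_real_derivative_along_line:
  fixes f :: "complex \<Rightarrow> real"
  assumes "f differentiable (at (a + of_real t * q))"
  shows "((\<lambda>t. f (a + of_real t * q)) has_real_derivative
           frechet_derivative f (at (a + of_real t * q)) q) (at t)"
proof -
  let ?F = "frechet_derivative f (at (a + of_real t * q))"
  have d: "(f has_derivative ?F) (at (a + of_real t * q))"
    using assms frechet_derivative_works by blast
  have "((\<lambda>t. a + of_real t * q) has_derivative (\<lambda>s. of_real s * q)) (at t)"
    by (auto intro!: derivative_eq_intros)
  from diff_chain_at[OF this d]
  have "((\<lambda>t. f (a + of_real t * q)) has_derivative (\<lambda>s. ?F (of_real s * q))) (at t)"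
    by (simp add: o_def)
  moreover have "?F (of_real s * q) = ?F q * s" for s
    using linear_scale[OF linear_frechet_derivative[OF assms], of s q]
    by (simp add: scaleR_conv_of_real mult.commute)
  ultimately show ?thesis
    by (simp add: has_field_derivative_def)
qed

text \<open>
  Applied with the two coordinate directions in either order, the left-hand side is the same
  number, which is how it serves to compare mixed partial derivatives.
\<close>

lemma second_difference_mean_value:
  fixes u :: "complex \<Rightarrow> real"
  assumes "0 < k"
    and u: "\<And>s t. 0 \<le> s \<Longrightarrow> s \<le> k \<Longrightarrow> 0 \<le> t \<Longrightarrow> t \<le> k \<Longrightarrow>
              u differentiable (at (z + of_real t * q + of_real s * p))"
    and up: "\<And>s t. 0 \<le> s \<Longrightarrow> s \<le> k \<Longrightarrow> 0 \<le> t \<Longrightarrow> t \<le> k \<Longrightarrow>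
       (\<lambda>w. frechet_derivative u (at w) p) differentiable (at (z + of_real s * p + of_real t * q))"
  obtains s t where "0 < s" "s < k" "0 < t" "t < k"
    "u (z + of_real k * p + of_real k * q) - u (z + of_real k * p) - u (z + of_real k * q) + u z
     = k\<^sup>2 * frechet_derivative (\<lambda>w. frechet_derivative u (at w) p)
              (at (z + of_real s * p + of_real t * q)) q"
proof -
  let ?up = "\<lambda>w. frechet_derivative u (at w) p"
  define \<phi> where "\<phi> s = u (z + of_real k * q + of_real s * p) - u (z + of_real s * p)" for s
  have "(\<phi> has_real_derivative (?up (z + of_real k * q + of_real s * p) - ?up (z + of_real s * p))) (at s)"
    if "0 \<le> s" "s \<le> k" for s
    unfolding \<phi>_def
    using u[of s k] u[of s 0] that \<open>0 < k\<close>
      has_real_derivative_along_line[of u "z + of_real k * q" s p]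
      has_real_derivative_along_line[of u z s p]
    by (intro DERIV_diff) auto
  then obtain s where s: "0 < s" "s < k"
    "\<phi> k - \<phi> 0 = (k - 0) * (?up (z + of_real k * q + of_real s * p) - ?up (z + of_real s * p))"
    using MVT2[OF \<open>0 < k\<close>, of \<phi>
        "\<lambda>s. ?up (z + of_real k * q + of_real s * p) - ?up (z + of_real s * p)"] by blast
  have "((\<lambda>t. ?up (z + of_real s * p + of_real t * q)) has_real_derivative
      frechet_derivative ?up (at (z + of_real s * p + of_real t * q)) q) (at t)"
    if "0 \<le> t" "t \<le> k" for t
    using up[of s t] that s
      has_real_derivative_along_line[of ?up "z + of_real s * p" t q] by simp
  then obtain t where t: "0 < t" "t < k"
    "?up (z + of_real s * p + of_real k * q) - ?up (z + of_real s * p + of_real 0 * q) =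
      (k - 0) * frechet_derivative ?up (at (z + of_real s * p + of_real t * q)) q"
    using MVT2[OF \<open>0 < k\<close>, of "\<lambda>t. ?up (z + of_real s * p + of_real t * q)"
        "\<lambda>t. frechet_derivative ?up (at (z + of_real s * p + of_real t * q)) q"] by blast
  show ?thesis
  proof (rule that[OF s(1,2) t(1,2)])
    have "u (z + of_real k * p + of_real k * q) - u (z + of_real k * p) - u (z + of_real k * q) + u z
        = \<phi> k - \<phi> 0"
      by (simp add: \<phi>_def algebra_simps)
    also have "\<dots> = k * (?up (z + of_real s * p + of_real k * q) - ?up (z + of_real s * p + of_real 0 * q))"
      using s(3) by (simp add: algebra_simps)
    also have "\<dots> = k\<^sup>2 * frechet_derivative ?up (at (z + of_real s * p + of_real t * q)) q"
      unfolding t(3) by (simp add: power2_eq_square)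
    finally show "u (z + of_real k * p + of_real k * q) - u (z + of_real k * p) - u (z + of_real k * q) + u z
     = k\<^sup>2 * frechet_derivative ?up (at (z + of_real s * p + of_real t * q)) q" .
  qed
qed

text \<open>
  Schwarz's theorem on mixed partial derivatives, from the double mean value theorem on
  shrinking squares.
\<close>

lemma C2_on_mixed_partials_eq:
  fixes u :: "complex \<Rightarrow> real"
  assumes C2: "C2_on u S" and "open S" "z \<in> S"
  shows "partial_y (partial_x u) z = partial_x (partial_y u) z"
proof (rule ccontr)
  let ?a = "partial_y (partial_x u)" and ?b = "partial_x (partial_y u)"
  assume ne: "?a z \<noteq> ?b z"
  define e where "e = \<bar>?a z - ?b z\<bar> / 2"
  have "e > 0" using ne by (simp add: e_def)
  obtain r where r: "r > 0" "ball z r \<subseteq> S"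
    using \<open>open S\<close> \<open>z \<in> S\<close> open_contains_ball by blast
  have ca: "continuous_on S ?a" and cb: "continuous_on S ?b"
    using C2 by (auto simp: C2_on_def C1_on_def)
  obtain d1 where d1: "d1 > 0" "\<And>w. w \<in> S \<Longrightarrow> dist w z < d1 \<Longrightarrow> dist (?a w) (?a z) < e"
    using ca \<open>z \<in> S\<close> \<open>e > 0\<close> unfolding continuous_on_iff by blast
  obtain d2 where d2: "d2 > 0" "\<And>w. w \<in> S \<Longrightarrow> dist w z < d2 \<Longrightarrow> dist (?b w) (?b z) < e"
    using cb \<open>z \<in> S\<close> \<open>e > 0\<close> unfolding continuous_on_iff by blast
  define k where "k = min r (min d1 d2) / 3"
  have k: "0 < k" "2 * k < r" "2 * k < d1" "2 * k < d2"
    using r d1 d2 by (auto simp: k_def)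
  have near: "dist (z + of_real s * p + of_real t * q) z \<le> 2 * k"
    if "0 \<le> s" "s \<le> k" "0 \<le> t" "t \<le> k" "norm p = 1" "norm q = 1" for s t and p q :: complex
    using that norm_triangle_ineq[of "of_real s * p" "of_real t * q"]
    by (simp add: dist_norm norm_mult add.assoc)
  have inS: "z + of_real s * p + of_real t * q \<in> S"
    if "0 \<le> s" "s \<le> k" "0 \<le> t" "t \<le> k" "norm p = 1" "norm q = 1" for s t and p q :: complex
    using near[OF that] k r(2) by (auto simp: dist_commute subset_iff)
  have dif: "\<And>w. w \<in> S \<Longrightarrow> u differentiable (at w)" "\<And>w. w \<in> S \<Longrightarrow> partial_x u differentiable (at w)"
    "\<And>w. w \<in> S \<Longrightarrow> partial_y u differentiable (at w)"
    using C2 by (auto simp: C2_on_def C1_on_def)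
  have px: "partial_x f = (\<lambda>w. frechet_derivative f (at w) 1)"
    and py: "partial_y f = (\<lambda>w. frechet_derivative f (at w) \<i>)" for f :: "complex \<Rightarrow> real"
    by (auto simp: partial_x_def partial_y_def)
  obtain s t where st: "0 < s" "s < k" "0 < t" "t < k"
    "u (z + of_real k * 1 + of_real k * \<i>) - u (z + of_real k * 1) - u (z + of_real k * \<i>) + u z
     = k\<^sup>2 * ?a (z + of_real s * 1 + of_real t * \<i>)"
  proof (rule second_difference_mean_value[OF k(1), where u = u and z = z and p = 1 and q = \<i>])
    fix s t assume "0 \<le> s" "s \<le> k" "0 \<le> t" "t \<le> k"
    then show "u differentiable (at (z + of_real t * \<i> + of_real s * 1))"
      "(\<lambda>w. frechet_derivative u (at w) 1) differentiable (at (z + of_real s * 1 + of_real t * \<i>))"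
      using dif(1)[OF inS[of t s \<i> 1]] dif(2)[OF inS[of s t 1 \<i>]] by (simp_all add: px)
  qed (rule that; simp only: px py)
  obtain s' t' where st': "0 < s'" "s' < k" "0 < t'" "t' < k"
    "u (z + of_real k * \<i> + of_real k * 1) - u (z + of_real k * \<i>) - u (z + of_real k * 1) + u z
     = k\<^sup>2 * ?b (z + of_real s' * \<i> + of_real t' * 1)"
  proof (rule second_difference_mean_value[OF k(1), where u = u and z = z and p = \<i> and q = 1])
    fix s t assume "0 \<le> s" "s \<le> k" "0 \<le> t" "t \<le> k"
    then show "u differentiable (at (z + of_real t * 1 + of_real s * \<i>))"
      "(\<lambda>w. frechet_derivative u (at w) \<i>) differentiable (at (z + of_real s * \<i> + of_real t * 1))"
      using dif(1)[OF inS[of t s 1 \<i>]] dif(3)[OF inS[of s t \<i> 1]] by (simp_all add: py)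
  qed (rule that; simp only: px py)
  let ?w = "z + of_real s * 1 + of_real t * \<i>" and ?w' = "z + of_real s' * \<i> + of_real t' * 1"
  have "k\<^sup>2 * ?a ?w = k\<^sup>2 * ?b ?w'"
  proof -
    have "u (z + of_real k * 1 + of_real k * \<i>) = u (z + of_real k * \<i> + of_real k * 1)"
      by (simp add: add_ac)
    then show ?thesis using st(5) st'(5) by linarith
  qed
  then have eq: "?a ?w = ?b ?w'" using k(1) by simp
  have A1: "dist (?a ?w) (?a z) < e"
    using d1(2)[of ?w] near[of s t 1 \<i>] inS[of s t 1 \<i>] st k by force
  have A2: "dist (?b ?w') (?b z) < e"
    using d2(2)[of ?w'] near[of s' t' \<i> 1] inS[of s' t' \<i> 1] st' k by force
  have "dist (?a z) (?b z) \<le> dist (?a ?w) (?a z) + dist (?b ?w') (?b z)"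
    using dist_triangle3[of "?a z" "?b z" "?a ?w"] unfolding eq .
  from le_less_trans[OF this add_strict_mono[OF A1 A2]] show False
    by (simp add: e_def dist_real_def)
qed

text \<open>
  The function \<open>u\<^sub>x - \<i> u\<^sub>y\<close> satisfies the Cauchy-Riemann equations: one is \<open>\<Delta>u = 0\<close>, the
  other is the symmetry of the mixed derivatives. Its primitive has real part \<open>u\<close> up to a
  constant.
\<close>

lemma harmonic_imp_Re_holomorphic:
  assumes u: "harmonic_on u S" and S: "open S" "connected S" "simply_connected S"
  obtains H where "H holomorphic_on S" "\<And>z. z \<in> S \<Longrightarrow> u z = Re (H z)"
proof (cases "S = {}")
  case True
  then show ?thesis using that[of "\<lambda>z. 0"] by simp
next
  case False
  then obtain a where a: "a \<in> S" by blast
  have C2: "C2_on u S" and lap: "\<And>z. z \<in> S \<Longrightarrow> partial_x (partial_x u) z + partial_y (partial_y u) z = 0"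
    using u by (auto simp: harmonic_on_def)
  have dif: "\<And>w. w \<in> S \<Longrightarrow> u differentiable (at w)" "\<And>w. w \<in> S \<Longrightarrow> partial_x u differentiable (at w)"
    "\<And>w. w \<in> S \<Longrightarrow> partial_y u differentiable (at w)"
    using C2 by (auto simp: C2_on_def C1_on_def)
  have expand: "frechet_derivative f (at z) v = Re v * partial_x f z + Im v * partial_y f z"
    if "f differentiable (at z)" for f :: "complex \<Rightarrow> real" and z v
  proof -
    interpret L: linear "frechet_derivative f (at z)"
      using that by (rule linear_frechet_derivative)
    have "v = Re v *\<^sub>R 1 + Im v *\<^sub>R \<i>" by (simp add: complex_eq_iff)
    then have "frechet_derivative f (at z) v = Re v *\<^sub>R partial_x f z + Im v *\<^sub>R partial_y f z"
      unfolding partial_x_def partial_y_def by (metis L.add L.scaleR)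
    then show ?thesis by simp
  qed
  have hasd: "(f has_derivative (\<lambda>v. Re v * partial_x f z + Im v * partial_y f z)) (at z)"
    if "f differentiable (at z)" for f :: "complex \<Rightarrow> real" and z
  proof -
    have "frechet_derivative f (at z) = (\<lambda>v. Re v * partial_x f z + Im v * partial_y f z)"
      using expand[OF that] by (rule ext)
    then show ?thesis using that frechet_derivative_works[of f "at z"] by simp
  qed
  define F where "F z = Complex (partial_x u z) (- partial_y u z)" for z
  have "(F has_field_derivative Complex (partial_x (partial_x u) z) (- partial_x (partial_y u) z)) (at z)"
    if z: "z \<in> S" for z
  proof -
    have "((\<lambda>w. of_real (partial_x u w) - \<i> * of_real (partial_y u w)) has_derivative
      (\<lambda>v. of_real (Re v * partial_x (partial_x u) z + Im v * partial_y (partial_x u) z)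
         - \<i> * of_real (Re v * partial_x (partial_y u) z + Im v * partial_y (partial_y u) z))) (at z)"
      by (intro derivative_intros hasd dif z)
    moreover have "(\<lambda>w. of_real (partial_x u w) - \<i> * of_real (partial_y u w)) = F"
      by (auto simp: F_def complex_eq_iff)
    ultimately have d: "(F has_derivative
      (\<lambda>v. of_real (Re v * partial_x (partial_x u) z + Im v * partial_y (partial_x u) z)
         - \<i> * of_real (Re v * partial_x (partial_y u) z + Im v * partial_y (partial_y u) z))) (at z)"
      by simp
    have "partial_y (partial_y u) z = - partial_x (partial_x u) z"
      using lap[OF z] by simp
    then show ?thesis
      unfolding has_field_derivative_def using C2_on_mixed_partials_eq[OF C2 S(1) z]
      by (intro has_derivative_eq_rhs[OF d]) (auto simp: fun_eq_iff complex_eq_iff)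
  qed
  then have "F holomorphic_on S"
    using holomorphic_on_open[OF S(1)] by blast
  then obtain G where G: "\<And>z. z \<in> S \<Longrightarrow> (G has_field_derivative F z) (at z)"
    using S simply_connected_eq_global_primitive[OF S(1)] by blast
  have der0: "((\<lambda>w. u w - Re (G w)) has_derivative (\<lambda>v. 0)) (at z)" if z: "z \<in> S" for z
  proof -
    have "((\<lambda>w. u w - Re (G w)) has_derivative
        (\<lambda>v. (Re v * partial_x u z + Im v * partial_y u z) - Re (F z * v))) (at z)"
      using G[OF z] by (intro derivative_intros hasd dif z) (auto simp: has_field_derivative_def)
    moreover have "(\<lambda>v. (Re v * partial_x u z + Im v * partial_y u z) - Re (F z * v)) = (\<lambda>v. 0)"
      by (auto simp: F_def)
    ultimately show ?thesis by simp
  qed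
  define c where "c = u a - Re (G a)"
  have c: "u z - Re (G z) = c" if "z \<in> S" for z
    unfolding c_def using has_derivative_zero_unique_connected[OF S(1,2) der0 that a] .
  show ?thesis
  proof (rule that[of "\<lambda>z. G z + of_real c"])
    show "(\<lambda>z. G z + of_real c) holomorphic_on S"
      using G holomorphic_on_open[OF S(1), of G] by (intro holomorphic_intros) blast
    show "u z = Re (G z + of_real c)" if "z \<in> S" for z
      using c[OF that] by simp
  qed
qed

lemma harmonic_mapping_canonical_decomposition:
  assumes f: "harmonic_mapping_on f S" and S: "open S" "connected S" "simply_connected S"
  obtains h g where "h holomorphic_on S" "g holomorphic_on S" "\<And>z. z \<in> S \<Longrightarrow> f z = h z + cnj (g z)"
proof -
  obtain A where A: "A holomorphic_on S" "\<And>z. z \<in> S \<Longrightarrow> Re (f z) = Re (A z)"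
    using f harmonic_imp_Re_holomorphic[OF _ S] unfolding harmonic_mapping_on_def by metis
  obtain B where B: "B holomorphic_on S" "\<And>z. z \<in> S \<Longrightarrow> Im (f z) = Re (B z)"
    using f harmonic_imp_Re_holomorphic[OF _ S] unfolding harmonic_mapping_on_def by metis
  show ?thesis
  proof (rule that[of "\<lambda>z. (A z + \<i> * B z) / 2" "\<lambda>z. (A z - \<i> * B z) / 2"])
    show "f z = (A z + \<i> * B z) / 2 + cnj ((A z - \<i> * B z) / 2)" if "z \<in> S" for z
      using A(2)[OF that] B(2)[OF that] by (simp add: complex_eq_iff field_simps)
  qed (intro holomorphic_intros A(1) B(1); simp)+
qed

lemma harmonic_sum_has_derivative:
  assumes "h holomorphic_on S" "g holomorphic_on S" "open S" "z \<in> S"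
    and f: "\<And>w. w \<in> S \<Longrightarrow> f w = h w + cnj (g w)"
  shows "(f has_derivative (\<lambda>v. deriv h z * v + cnj (deriv g z * v))) (at z)"
proof -
  have "(h has_derivative (\<lambda>v. deriv h z * v)) (at z)" "(g has_derivative (\<lambda>v. deriv g z * v)) (at z)"
    using holomorphic_derivI[OF assms(1,3,4)] holomorphic_derivI[OF assms(2,3,4)]
    by (auto simp: has_field_derivative_def)
  then have "((\<lambda>w. h w + cnj (g w)) has_derivative (\<lambda>v. deriv h z * v + cnj (deriv g z * v))) (at z)"
    by (intro derivative_intros)
  then show ?thesis
    by (rule has_derivative_transform_within_open[OF _ assms(3,4)]) (simp add: f)
qed

lemma Lambda_harmonic_sum:
  assumes "h holomorphic_on S" "g holomorphic_on S" "open S" "z \<in> S"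
    and f: "\<And>w. w \<in> S \<Longrightarrow> f w = h w + cnj (g w)"
  shows "Lambda f z = norm (deriv h z) + norm (deriv g z)"
proof -
  have d: "(f has_derivative (\<lambda>v. deriv h z * v + cnj (deriv g z * v))) (at z)"
    by (rule harmonic_sum_has_derivative[OF assms])
  then have eq: "frechet_derivative f (at z) = (\<lambda>v. deriv h z * v + cnj (deriv g z * v))"
    using frechet_derivative_at by metis
  have "f differentiable (at z)" using d differentiable_def by blast
  moreover have "d_z f z = deriv h z" "d_zbar f z = cnj (deriv g z)"
    by (simp_all add: d_z_def d_zbar_def partial_x_def partial_y_def eq complex_eq_iff)
  ultimately show ?thesis using Lambda_eq(1) by simp
qed

section \<open>Lewy's theorem for univalent harmonic maps\<close>

text \<open>
  Two curves on a line that leave the same point and do not meet again must run in opposite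
  directions. Hence at most two such curves exist, which is what contradicts the three arms of
  a level set at a critical point.
\<close>

lemma disjoint_ranges_imp_opposite_signs:
  fixes p q :: "real \<Rightarrow> real"
  assumes "0 < d" and p: "continuous_on {0..d} p" and q: "continuous_on {0..d} q"
    and 0: "p 0 = 0" "q 0 = 0"
    and dis: "\<And>s t. 0 \<le> s \<Longrightarrow> s \<le> d \<Longrightarrow> 0 \<le> t \<Longrightarrow> t \<le> d \<Longrightarrow> p s = q t \<Longrightarrow> s = 0 \<and> t = 0"
  shows "p d * q d < 0"
proof (rule ccontr)
  have nz: "p d \<noteq> 0" "q d \<noteq> 0"
    using dis[of d 0] dis[of 0 d] 0 \<open>0 < d\<close> by auto
  assume "\<not> p d * q d < 0"
  then consider "0 < p d" "p d \<le> q d" | "0 < q d" "q d \<le> p d"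
    | "p d < 0" "q d \<le> p d" | "q d < 0" "p d \<le> q d"
    using nz by (force simp: mult_less_0_iff)
  then show False
  proof cases
    case 1
    then obtain t where "0 \<le> t" "t \<le> d" "q t = p d"
      using IVT'[of q 0 "p d" d] q 0 \<open>0 < d\<close> by force
    then show False using dis[of d t] \<open>0 < d\<close> by auto
  next
    case 2
    then obtain t where "0 \<le> t" "t \<le> d" "p t = q d"
      using IVT'[of p 0 "q d" d] p 0 \<open>0 < d\<close> by force
    then show False using dis[of t d] \<open>0 < d\<close> by auto
  next
    case 3
    then obtain t where "0 \<le> t" "t \<le> d" "q t = p d"
      using IVT2'[of q d "p d" 0] q 0 \<open>0 < d\<close> by force
    then show False using dis[of d t] \<open>0 < d\<close> by auto
  next
    case 4
    then obtain t where "0 \<le> t" "t \<le> d" "p t = q d"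
      using IVT2'[of p d "q d" 0] p 0 \<open>0 < d\<close> by force
    then show False using dis[of t d] \<open>0 < d\<close> by auto
  qed
qed

lemma cis_odd_angle_power:
  assumes "0 < n"
  shows "Re (cis (pi * (2 * real j + 1) / (2 * real n)) ^ n) = 0"
proof -
  have "cis (pi * (2 * real j + 1) / (2 * real n)) ^ n = cis (pi * (2 * real j + 1) / 2)"
  proof -
    have "real n * (pi * (2 * real j + 1) / (2 * real n)) = pi * (2 * real j + 1) / 2"
      using assms by simp
    then show ?thesis unfolding Complex.DeMoivre by (rule arg_cong)
  qed
  moreover have "pi * (2 * real j + 1) / 2 = real j * pi + pi / 2"
    by (simp add: field_simps)
  ultimately show ?thesis by (simp add: cos_add)
qed

lemma cis_odd_angle_distinct:
  assumes "2 \<le> n" "j < 3" "k < 3" "j \<noteq> k"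
  shows "cis (pi * (2 * real j + 1) / (2 * real n)) \<noteq> cis (pi * (2 * real k + 1) / (2 * real n))"
proof
  assume eq: "cis (pi * (2 * real j + 1) / (2 * real n)) = cis (pi * (2 * real k + 1) / (2 * real n))"
  have mono: False if "j < k" "k < 3" "cis (pi * (2 * real j + 1) / (2 * real n)) = cis (pi * (2 * real k + 1) / (2 * real n))" for j k :: nat
  proof -
    have "cis (pi * (2 * real k + 1) / (2 * real n) - pi * (2 * real j + 1) / (2 * real n)) = 1"
      using that(3) by (simp flip: cis_divide)
    moreover have "pi * (2 * real k + 1) / (2 * real n) - pi * (2 * real j + 1) / (2 * real n)
        = pi * (real k - real j) / real n"
      using assms(1) by (simp add: field_simps)
    ultimately have c1: "cos (pi * (real k - real j) / real n) = 1"
      by (metis cis.simps(1) one_complex.simps(1))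
    have "0 < pi * (real k - real j) / real n"
      using that assms(1) by simp
    moreover have "pi * (real k - real j) / real n \<le> pi"
    proof -
      have "pi * (real k - real j) \<le> pi * real n"
        using that assms(1) by (intro mult_left_mono) auto
      then show ?thesis using assms(1) by (simp add: divide_le_eq)
    qed
    ultimately have "cos (pi * (real k - real j) / real n) < cos 0"
      by (intro cos_monotone_0_pi) auto
    then show False using c1 by simp
  qed
  show False
    using assms eq mono[of j k] mono[of k j] by (cases "j < k") auto
qed

text \<open>
  At a critical point \<open>H - H z0\<close> is the \<open>n\<close>-th power of a local coordinate with \<open>n \<ge> 2\<close>, so at
  least three arms of the level set of \<open>Re H\<close> emanate from \<open>z0\<close>. The injective map sends them
  to curves in one vertical line that meet only in the image of \<open>z0\<close>, but a line has room for
  two.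
\<close>

lemma inj_with_Re_imp_deriv_nonzero:
  fixes v :: "complex \<Rightarrow> real"
  assumes H: "H holomorphic_on S" and S: "open S" "connected S" "z0 \<in> S"
    and v: "continuous_on S v" and inj: "inj_on (\<lambda>z. Complex (Re (H z)) (v z)) S"
  shows "deriv H z0 \<noteq> 0"
proof
  assume crit: "deriv H z0 = 0"
  have injD: "x = y" if "x \<in> S" "y \<in> S" "Re (H x) = Re (H y)" "v x = v y" for x y
    using inj that by (auto simp: inj_on_def)
  have "\<exists>n>0. (deriv ^^ n) H z0 \<noteq> 0"
  proof (rule ccontr)
    assume "\<not> (\<exists>n>0. (deriv ^^ n) H z0 \<noteq> 0)"
    then have const: "H w = H z0" if "w \<in> S" for w
      using holomorphic_fun_eq_const_on_connected[OF H S(1,2) _ S(3) that] by blast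
    let ?F = "\<lambda>z. Complex (Re (H z)) (v z)"
    have "continuous_on S ?F"
      unfolding Complex_eq
      by (intro continuous_intros v holomorphic_on_imp_continuous_on H)
    then have "open (?F ` S)" by (rule invariance_of_domain[OF _ S(1) inj])
    then obtain e where e: "e > 0" "ball (?F z0) e \<subseteq> ?F ` S"
      using S(3) open_contains_ball by blast
    have "?F z0 + of_real (e/2) \<in> ?F ` S"
      using e by (intro subsetD[OF e(2)]) (simp add: dist_norm)
    then obtain w where w: "w \<in> S" "?F z0 + of_real (e/2) = ?F w" by blast
    show False
      using arg_cong[OF w(2), of Re] const[OF w(1)] e(1) by simp
  qed
  then obtain n where n: "n > 0" "(deriv ^^ n) H z0 \<noteq> 0"
    "\<And>i. 0 < i \<Longrightarrow> i < n \<Longrightarrow> (deriv ^^ i) H z0 = 0"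
    using exists_least_iff[of "\<lambda>n. n > 0 \<and> (deriv ^^ n) H z0 \<noteq> 0"] by auto
  have "n \<noteq> 1" using n(2) crit by auto
  then have n2: "2 \<le> n" using n(1) by linarith
  obtain g r where g: "0 < r" "g holomorphic_on ball z0 r"
    "\<And>w. w \<in> ball z0 r \<Longrightarrow> H w - H z0 = ((w - z0) * g w) ^ n"
    "\<And>w. w \<in> ball z0 r \<Longrightarrow> g w \<noteq> 0"
    using holomorphic_factor_order_of_zero_strong[OF H S(1,3) n] by metis
  obtain r0 where r0: "r0 > 0" "ball z0 r0 \<subseteq> S"
    using S open_contains_ball by blast
  define B where "B = ball z0 (min r r0)"
  define \<zeta> where "\<zeta> w = (w - z0) * g w" for w
  have B: "open B" "z0 \<in> B" "B \<subseteq> S" "B \<subseteq> ball z0 r"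
    using g(1) r0 by (auto simp: B_def)
  have gB: "g holomorphic_on B" using g(2) B(4) holomorphic_on_subset by blast
  have hol: "\<zeta> holomorphic_on B"
    unfolding \<zeta>_def by (intro holomorphic_intros gB)
  have "(\<zeta> has_field_derivative ((z0 - z0) * deriv g z0 + g z0)) (at z0)"
    unfolding \<zeta>_def using holomorphic_derivI[OF gB B(1,2)]
    by (auto intro!: derivative_eq_intros)
  then have "deriv \<zeta> z0 \<noteq> 0"
    using g(4)[of z0] g(1) DERIV_imp_deriv by force
  then obtain r1 where r1: "r1 > 0" "ball z0 r1 \<subseteq> B" "open (\<zeta> ` ball z0 r1)" "inj_on \<zeta> (ball z0 r1)"
    using has_complex_derivative_locally_invertible[OF hol B(2,1)] by metis
  have hol1: "\<zeta> holomorphic_on ball z0 r1" using hol r1(2) holomorphic_on_subset by blast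
  obtain k where k: "k holomorphic_on \<zeta> ` ball z0 r1" "\<And>z. z \<in> ball z0 r1 \<Longrightarrow> k (\<zeta> z) = z"
    using holomorphic_has_inverse[OF hol1 open_ball r1(4)] by metis
  have z00: "\<zeta> z0 = 0" by (simp add: \<zeta>_def)
  then have "0 \<in> \<zeta> ` ball z0 r1" using r1(1) by (metis centre_in_ball image_eqI)
  then obtain d where d: "d > 0" "cball 0 d \<subseteq> \<zeta> ` ball z0 r1"
    using r1(3) open_contains_cball by blast
  \<comment> \<open>The unit vectors \<open>\<omega> j\<close> satisfy \<open>Re (\<omega> j ^ n) = 0\<close>; the first three are distinct
    since \<open>n \<ge> 2\<close>.\<close>
  define \<omega> where "\<omega> j = cis (pi * (2 * real j + 1) / (2 * real n))" for j :: nat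
  define A where "A j t = k (of_real t * \<omega> j)" for j :: nat and t :: real
  define p where "p j t = v (A j t) - v z0" for j :: nat and t :: real
  have in_d: "of_real t * \<omega> j \<in> \<zeta> ` ball z0 r1" if "0 \<le> t" "t \<le> d" for t j
    using that d(2) by (auto simp: \<omega>_def norm_mult intro!: subsetD[OF d(2)])
  have zA: "\<zeta> (A j t) = of_real t * \<omega> j" and A_in: "A j t \<in> ball z0 r1" if "0 \<le> t" "t \<le> d" for t j
    using in_d[OF that, of j] k(2) unfolding A_def by auto
  have A_S: "A j t \<in> S" if "0 \<le> t" "t \<le> d" for t j
    using A_in[OF that] r1(2) B(3) by blast
  have ReA: "Re (H (A j t)) = Re (H z0)" if "0 \<le> t" "t \<le> d" for t j
  proof -
    have "H (A j t) - H z0 = (of_real t * \<omega> j) ^ n"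
      using g(3)[of "A j t"] A_in[OF that, of j] r1(2) B(4) zA[OF that, of j]
      unfolding \<zeta>_def by force
    then have "Re (H (A j t)) - Re (H z0) = Re (of_real (t ^ n) * \<omega> j ^ n)"
      by (metis minus_complex.sel(1) power_mult_distrib of_real_power)
    then show ?thesis
      using cis_odd_angle_power[OF n(1), of j] by (simp add: \<omega>_def)
  qed
  have contp: "continuous_on {0..d} (p j)" for j
  proof -
    have "continuous_on {0..d} (A j)"
      unfolding A_def
      by (rule continuous_on_compose2[OF holomorphic_on_imp_continuous_on[OF k(1)]])
        (auto intro!: continuous_intros in_d)
    then have "continuous_on {0..d} (\<lambda>t. v (A j t))"
      by (rule continuous_on_compose2[OF v]) (auto intro!: A_S)
    then show ?thesis unfolding p_def by (intro continuous_intros)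
  qed
  have A0: "A j 0 = z0" for j
    using k(2)[of z0] r1(1) z00 by (simp add: A_def)
  have neg: "p i d * p j d < 0" if "i < 3" "j < 3" "i \<noteq> j" for i j
  proof (rule disjoint_ranges_imp_opposite_signs[OF d(1) contp contp])
    show "p i 0 = 0" "p j 0 = 0" by (simp_all add: p_def A0)
    fix s t assume st: "0 \<le> s" "s \<le> d" "0 \<le> t" "t \<le> d" "p i s = p j t"
    then have "A i s = A j t"
      using A_S ReA by (intro injD) (auto simp: p_def)
    then have e: "of_real s * \<omega> i = of_real t * \<omega> j"
      using zA st by metis
    then have "norm (of_real s * \<omega> i) = norm (of_real t * \<omega> j)" by simp
    then have "s = t" using st by (simp add: \<omega>_def norm_mult)
    moreover have "\<omega> i \<noteq> \<omega> j"
      unfolding \<omega>_def by (rule cis_odd_angle_distinct[OF n2 that])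
    ultimately show "s = 0 \<and> t = 0" using e by auto
  qed
  show False
    using neg[of 0 1] neg[of 1 2] neg[of 0 2] by (auto simp: mult_less_0_iff)
qed

text \<open>
  If the moduli agree at \<open>z\<close>, the differential of \<open>f = h + cnj g\<close> is degenerate there, so some
  rotation \<open>cnj e * f\<close> has a real part with vanishing gradient. That real part is the real
  part of the holomorphic function \<open>cnj e * h + e * g\<close>, to which the previous lemma applies.
\<close>

lemma Lewy:
  assumes h: "h holomorphic_on S" and g: "g holomorphic_on S" and S: "open S" "connected S" "z \<in> S"
    and inj: "inj_on (\<lambda>z. h z + cnj (g z)) S"
  shows "norm (deriv h z) \<noteq> norm (deriv g z)"
proof
  assume eq: "norm (deriv h z) = norm (deriv g z)"
  obtain e where e: "norm e = 1" "cnj e * deriv h z + e * deriv g z = 0"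
  proof (cases "deriv g z = 0")
    case True
    then show ?thesis using that[of 1] eq by simp
  next
    case False
    \<comment> \<open>A unit vector with \<open>cnj e * h' + e * g' = cnj e * (h' + e\<^sup>2 * g') = 0\<close>.\<close>
    define e where "e = csqrt (- deriv h z / deriv g z)"
    have e2: "e * e = - deriv h z / deriv g z"
      unfolding e_def by (metis power2_csqrt power2_eq_square)
    have "norm e * norm e = 1"
      using arg_cong[OF e2, of norm] eq False by (simp add: norm_mult norm_divide)
    then have n1: "norm e = 1"
      by (metis norm_ge_zero mult_cancel_left1 power2_eq_iff_nonneg power2_eq_square zero_le_one mult_1)
    then have "cnj e * e = 1" by (metis complex_norm_square mult.commute of_real_1 power_one)
    then have "cnj e * deriv h z + e * deriv g z = cnj e * deriv h z + (cnj e * e) * (e * deriv g z)"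
      by simp
    also have "\<dots> = cnj e * (deriv h z + e * e * deriv g z)"
      by (simp add: algebra_simps)
    also have "\<dots> = 0" using False by (simp add: e2)
    finally show ?thesis using that n1 by blast
  qed
  define H where "H z = cnj e * h z + e * g z" for z
  define v where "v z = Im (cnj e * (h z + cnj (g z)))" for z
  have "cnj e * e = 1" by (metis complex_norm_square mult.commute of_real_1 power_one e(1))
  then have e0: "cnj e \<noteq> 0" by auto
  have eqF: "Complex (Re (H z)) (v z) = cnj e * (h z + cnj (g z))" for z
    by (simp add: H_def v_def complex_eq_iff algebra_simps)
  have "deriv H z \<noteq> 0"
  proof (rule inj_with_Re_imp_deriv_nonzero[OF _ S])
    show "H holomorphic_on S" unfolding H_def by (intro holomorphic_intros h g)
    show "continuous_on S v"
      unfolding v_def by (intro continuous_intros holomorphic_on_imp_continuous_on h g)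
    show "inj_on (\<lambda>z. Complex (Re (H z)) (v z)) S"
      using inj e0 by (simp add: eqF inj_on_def)
  qed
  moreover have "(H has_field_derivative (cnj e * deriv h z + e * deriv g z)) (at z)"
    unfolding H_def
    by (intro DERIV_add DERIV_cmult holomorphic_derivI[OF h S(1,3)] holomorphic_derivI[OF g S(1,3)])
  ultimately show False using e(2) DERIV_imp_deriv by metis
qed

section \<open>A distortion theorem for univalent holomorphic functions\<close>

text \<open>
  Schottky's bound at radius 1/2 for functions of modulus at most 1 at the origin, times the
  factors of the following proof.
\<close>

definition omit_const :: real where
  "omit_const = 8 * exp (pi * exp (pi * (4 + 12)))"

text \<open>
  This is Koebe's theorem with a worse constant. With \<open>w\<close> omitted, \<open>(w - \<psi>) / (w - \<psi> 0)\<close> has a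
  square root \<open>s\<close>, normalised to \<open>s 0 = -1\<close>. It omits 0, and it omits 1 because \<open>\<psi>\<close> is
  injective. Schottky's theorem and Cauchy's estimate bound \<open>s' 0\<close>, which is half of
  \<open>\<psi>' 0 / (w - \<psi> 0)\<close>. The disc of radius 2 provides a closed unit disc in the domain.
\<close>

lemma weak_Koebe_unit_disc:
  assumes hol: "\<psi> holomorphic_on ball 0 2" and inj: "inj_on \<psi> (ball 0 2)" and w: "w \<notin> \<psi> ` ball 0 2"
  shows "norm (deriv \<psi> 0) \<le> omit_const * norm (w - \<psi> 0)"
proof -
  have ne: "w - \<psi> 0 \<noteq> 0" using w by force
  define F where "F z = (w - \<psi> z) / (w - \<psi> 0)" for z
  have F: "F holomorphic_on ball 0 2"
    unfolding F_def by (intro holomorphic_intros hol) (use ne in auto)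
  have "F z \<noteq> 0" if "z \<in> ball 0 2" for z
    using w that ne by (auto simp: F_def)
  then obtain q where q: "q holomorphic_on ball 0 2" "\<And>z. z \<in> ball 0 2 \<Longrightarrow> F z = (q z)\<^sup>2"
    using contractible_imp_holomorphic_sqrt[OF F convex_imp_contractible[OF convex_ball]] by auto
  have q0: "q 0 = 1 \<or> q 0 = -1"
  proof -
    have "(q 0)\<^sup>2 = 1" using q(2)[of 0] ne by (simp add: F_def)
    then show ?thesis by (simp add: power2_eq_1_iff)
  qed
  define s where "s z = - q z / q 0" for z
  have s: "s holomorphic_on ball 0 2" unfolding s_def using q0 by (intro holomorphic_intros q) auto
  have s2: "F z = (s z)\<^sup>2" if "z \<in> ball 0 2" for z
    using q(2)[OF that] q0 by (auto simp: s_def)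
  have s0: "s 0 = -1" using q0 by (auto simp: s_def)
  have bound: "norm (s z) \<le> exp (pi * exp (pi * (4 + 12)))" if "norm z \<le> 1/2" for z
  proof -
    have "norm (s z) \<le> exp (pi * exp (pi * (2 + 2 * 1 + 12 * (1/2) / (1 - 1/2))))"
    proof (rule Schottky[OF _ _ _ _ _ that])
      show "s holomorphic_on cball 0 1" using s by (rule holomorphic_on_subset) auto
      fix z :: complex assume "z \<in> cball 0 1"
      then have z: "z \<in> ball 0 2" by auto
      show "\<not> (s z = 0 \<or> s z = 1)"
      proof
        assume "s z = 0 \<or> s z = 1"
        then show False
        proof
          assume "s z = 0"
          then show False using s2[OF z] w z ne by (auto simp: F_def)
        next
          assume s1: "s z = 1"
          then have "\<psi> z = \<psi> 0" using s2[OF z] ne by (simp add: F_def field_simps)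
          then have "z = 0" using inj z by (auto simp: inj_on_def)
          then show False using s1 s0 by simp
        qed
      qed
    qed (simp_all add: s0)
    then show ?thesis by simp
  qed
  have "norm ((deriv ^^ 1) s 0) \<le> fact 1 * exp (pi * exp (pi * (4 + 12))) / (1/2) ^ 1"
  proof (rule Cauchy_inequality)
    show "s holomorphic_on ball 0 (1/2)" using s by (rule holomorphic_on_subset) auto
    show "continuous_on (cball 0 (1/2)) s"
      using s by (intro holomorphic_on_imp_continuous_on) (rule holomorphic_on_subset, auto)
  qed (use bound in auto)
  then have ds: "norm (deriv s 0) \<le> 2 * exp (pi * exp (pi * (4 + 12)))" by simp
  have dpsi: "(\<psi> has_field_derivative deriv \<psi> 0) (at 0)" "(s has_field_derivative deriv s 0) (at 0)"
    by (rule holomorphic_derivI[OF hol], simp, simp) (rule holomorphic_derivI[OF s], simp, simp)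
  have "((\<lambda>z. (s z)\<^sup>2) has_field_derivative (2 * s 0 * deriv s 0)) (at 0)"
    using dpsi(2) by (auto intro!: derivative_eq_intros)
  then have "(F has_field_derivative (2 * s 0 * deriv s 0)) (at 0)"
    by (rule has_field_derivative_transform_within_open[of _ _ _ "ball 0 2"]) (auto simp: s2)
  moreover have "(F has_field_derivative (- deriv \<psi> 0 / (w - \<psi> 0))) (at 0)"
    unfolding F_def using dpsi(1) ne by (auto intro!: derivative_eq_intros)
  ultimately have "- deriv \<psi> 0 / (w - \<psi> 0) = - 2 * deriv s 0"
    using DERIV_unique s0 by fastforce
  then have "deriv \<psi> 0 = 2 * deriv s 0 * (w - \<psi> 0)"
    using ne by (simp add: field_simps)
  then have "norm (deriv \<psi> 0) = 2 * norm (deriv s 0) * norm (w - \<psi> 0)"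
    by (simp add: norm_mult)
  also have "\<dots> \<le> 2 * (2 * exp (pi * exp (pi * (4 + 12)))) * norm (w - \<psi> 0)"
    using ds by (intro mult_right_mono mult_left_mono) auto
  also have "\<dots> \<le> omit_const * norm (w - \<psi> 0)"
    by (intro mult_right_mono) (auto simp: omit_const_def)
  finally show ?thesis .
qed

lemma weak_Koebe:
  assumes hol: "\<phi> holomorphic_on ball a R" and inj: "inj_on \<phi> (ball a R)" and "0 < R"
    and w: "w \<notin> \<phi> ` ball a R"
  shows "R * norm (deriv \<phi> a) \<le> 2 * omit_const * norm (w - \<phi> a)"
proof -
  define m where "m z = a + of_real (R / 2) * z" for z :: complex
  have m: "m ` ball 0 2 \<subseteq> ball a R"
  proof
    fix y assume "y \<in> m ` ball 0 2"
    then obtain z where "y = m z" "norm z < 2" by auto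
    moreover from this have "R * norm z < R * 2" using \<open>0 < R\<close> by simp
    ultimately show "y \<in> ball a R"
      using \<open>0 < R\<close> by (simp add: m_def dist_norm norm_mult)
  qed
  have "(\<phi> \<circ> m) holomorphic_on ball 0 2"
    using m by (intro holomorphic_on_compose_gen[OF _ hol]) (auto simp: m_def[abs_def] intro!: holomorphic_intros)
  moreover have "inj_on (\<phi> \<circ> m) (ball 0 2)"
    using \<open>0 < R\<close> by (intro comp_inj_on inj_on_subset[OF inj m]) (auto simp: m_def inj_on_def)
  moreover have "w \<notin> (\<phi> \<circ> m) ` ball 0 2" using w m by fastforce
  ultimately have "norm (deriv (\<phi> \<circ> m) 0) \<le> omit_const * norm (w - (\<phi> \<circ> m) 0)"
    by (rule weak_Koebe_unit_disc)
  moreover have "(\<phi> \<circ> m has_field_derivative (deriv \<phi> a * of_real (R / 2))) (at 0)"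
  proof (rule DERIV_chain)
    show "(m has_field_derivative of_real (R / 2)) (at 0)"
      unfolding m_def by (auto intro!: derivative_eq_intros)
    show "(\<phi> has_field_derivative deriv \<phi> a) (at (m 0))"
      using holomorphic_derivI[OF hol open_ball, of a] \<open>0 < R\<close> by (simp add: m_def)
  qed
  then have "norm (deriv (\<phi> \<circ> m) 0) = norm (deriv \<phi> a) * (R / 2)"
    using \<open>0 < R\<close> by (simp add: DERIV_imp_deriv norm_mult)
  ultimately show ?thesis by (simp add: m_def algebra_simps)
qed

section \<open>Continuation of inverse branches\<close>

text \<open>
  If injectivity failed in every neighbourhood of \<open>C\<close>, pairs with equal values would
  accumulate at two points of \<open>C\<close> with equal values, hence at a single point, contrary to
  local injectivity there.
\<close>

lemma locally_injective_near_compact: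
  fixes h :: "'a::real_normed_vector \<Rightarrow> 'b::t2_space"
  assumes cont: "continuous_on D h" and "open D" and C: "compact C" "C \<subseteq> D" and inj: "inj_on h C"
    and loc: "\<And>x. x \<in> C \<Longrightarrow> \<exists>r>0. inj_on h (ball x r)"
  obtains N where "open N" "C \<subseteq> N" "N \<subseteq> D" "inj_on h N"
proof -
  have "\<exists>e>0. inj_on h (D \<inter> (\<Union>x\<in>C. ball x e))"
  proof (rule ccontr)
    assume no: "\<not> ?thesis"
    have "\<exists>x y a b. x \<in> D \<and> y \<in> D \<and> a \<in> C \<and> b \<in> C \<and> dist a x < inverse (Suc n) \<and>
        dist b y < inverse (Suc n) \<and> h x = h y \<and> x \<noteq> y" for n
    proof -
      have "\<not> inj_on h (D \<inter> (\<Union>x\<in>C. ball x (inverse (Suc n))))"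
        using no by (metis inverse_positive_iff_positive of_nat_0_less_iff zero_less_Suc)
      then obtain x y where "x \<in> D \<inter> (\<Union>x\<in>C. ball x (inverse (Suc n)))"
        "y \<in> D \<inter> (\<Union>x\<in>C. ball x (inverse (Suc n)))" "h x = h y" "x \<noteq> y"
        unfolding inj_on_def by blast
      moreover from this obtain a b where "a \<in> C" "x \<in> ball a (inverse (Suc n))"
        "b \<in> C" "y \<in> ball b (inverse (Suc n))" by blast
      ultimately show ?thesis unfolding mem_ball by blast
    qed
    then obtain x y a b where xy: "\<And>n. x n \<in> D" "\<And>n. y n \<in> D" "\<And>n. a n \<in> C" "\<And>n. b n \<in> C"
      "\<And>n. dist (a n) (x n) < inverse (Suc n)" "\<And>n. dist (b n) (y n) < inverse (Suc n)"
      "\<And>n. h (x n) = h (y n)" "\<And>n. x n \<noteq> y n"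
      by metis
    have "compact (C \<times> C)" using C(1) C(1) by (rule compact_Times)
    then have seq: "seq_compact (C \<times> C)" by (simp add: compact_eq_seq_compact_metric)
    have "\<forall>n. (a n, b n) \<in> C \<times> C" using xy(3,4) by auto
    from seq_compactE[OF seq this] obtain l r where l: "l \<in> C \<times> C" "strict_mono r"
      "((\<lambda>n. (a n, b n)) \<circ> r) \<longlonglongrightarrow> l"
      by metis
    obtain p q where pq: "l = (p, q)" "p \<in> C" "q \<in> C" using l(1) by auto
    have ar: "(\<lambda>n. a (r n)) \<longlonglongrightarrow> p" "(\<lambda>n. b (r n)) \<longlonglongrightarrow> q"
      using tendsto_fst[OF l(3)] tendsto_snd[OF l(3)] pq by (simp_all add: o_def)
    have inv0: "(\<lambda>n. inverse (real (Suc (r n)))) \<longlonglongrightarrow> 0"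
      using LIMSEQ_subseq_LIMSEQ[OF LIMSEQ_inverse_real_of_nat l(2)] by (simp add: o_def)
    have xr: "(\<lambda>n. x (r n)) \<longlonglongrightarrow> p"
    proof (rule Lim_transform2[OF ar(1)])
      show "(\<lambda>n. a (r n) - x (r n)) \<longlonglongrightarrow> 0"
        by (rule Lim_null_comparison[OF _ inv0])
          (use xy(5) in \<open>auto simp: dist_norm intro!: always_eventually less_imp_le\<close>)
    qed
    have yr: "(\<lambda>n. y (r n)) \<longlonglongrightarrow> q"
    proof (rule Lim_transform2[OF ar(2)])
      show "(\<lambda>n. b (r n) - y (r n)) \<longlonglongrightarrow> 0"
        by (rule Lim_null_comparison[OF _ inv0])
          (use xy(6) in \<open>auto simp: dist_norm intro!: always_eventually less_imp_le\<close>)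
    qed
    have ch: "isCont h p" "isCont h q"
      using cont \<open>open D\<close> pq C(2) continuous_on_eq_continuous_at by blast+
    have "(\<lambda>n. h (x (r n))) \<longlonglongrightarrow> h p" "(\<lambda>n. h (x (r n))) \<longlonglongrightarrow> h q"
      using isCont_tendsto_compose[OF ch(1) xr] isCont_tendsto_compose[OF ch(2) yr] xy(7) by auto
    then have "h p = h q" using LIMSEQ_unique by blast
    then have "p = q" using inj pq by (auto simp: inj_on_def)
    obtain e where e: "e > 0" "inj_on h (ball p e)" using loc pq(2) by blast
    have "eventually (\<lambda>n. dist (x (r n)) p < e \<and> dist (y (r n)) p < e) sequentially"
      using xr yr e(1) \<open>p = q\<close> by (auto simp: tendsto_iff intro: eventually_conj)
    then obtain n where "dist (x (r n)) p < e" "dist (y (r n)) p < e"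
      using eventually_happens trivial_limit_sequentially by blast
    then have "x (r n) = y (r n)"
      using e(2) xy(7) by (auto simp: inj_on_def dist_commute)
    then show False using xy(8) by blast
  qed
  then obtain e where e: "e > 0" "inj_on h (D \<inter> (\<Union>x\<in>C. ball x e))" by blast
  show ?thesis
  proof (rule that[OF _ _ _ e(2)])
    show "open (D \<inter> (\<Union>x\<in>C. ball x e))" using \<open>open D\<close> by blast
  qed (use C(2) e(1) in auto)
qed

definition inverse_branch :: "(complex \<Rightarrow> complex) \<Rightarrow> complex set \<Rightarrow> complex \<Rightarrow> real \<Rightarrow> (complex \<Rightarrow> complex) \<Rightarrow> bool" where
  "inverse_branch h D z s \<phi> \<longleftrightarrow> \<phi> holomorphic_on ball (h z) s \<and> \<phi> ` ball (h z) s \<subseteq> D \<and>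
     (\<forall>\<zeta>\<in>ball (h z) s. h (\<phi> \<zeta>) = \<zeta>) \<and> \<phi> (h z) = z"

lemma inverse_branchD:
  assumes "inverse_branch h D z s \<phi>"
  shows "\<phi> holomorphic_on ball (h z) s" "\<And>\<zeta>. \<zeta> \<in> ball (h z) s \<Longrightarrow> \<phi> \<zeta> \<in> D"
    "\<And>\<zeta>. \<zeta> \<in> ball (h z) s \<Longrightarrow> h (\<phi> \<zeta>) = \<zeta>" "\<phi> (h z) = z"
  using assms by (auto simp: inverse_branch_def)

lemma inverse_branch_subset:
  "inverse_branch h D z s \<phi> \<Longrightarrow> s' \<le> s \<Longrightarrow> inverse_branch h D z s' \<phi>"
  unfolding inverse_branch_def
  by (auto intro: holomorphic_on_subset[OF _ subset_ball])

lemma inverse_branch_from_injective: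
  assumes h: "h holomorphic_on D" and "open N" "N \<subseteq> D" "inj_on h N" "z \<in> N"
    and s: "ball (h z) s \<subseteq> h ` N"
  obtains k where "inverse_branch h D z s k"
proof -
  obtain k where k: "k holomorphic_on h ` N" "\<And>z. z \<in> N \<Longrightarrow> k (h z) = z"
    using holomorphic_has_inverse[OF holomorphic_on_subset[OF h] assms(2,4)] assms(3) by metis
  have "inverse_branch h D z s k"
    unfolding inverse_branch_def
  proof (intro conjI ballI)
    show "k holomorphic_on ball (h z) s" using k(1) s by (rule holomorphic_on_subset)
    show "k (h z) = z" using k(2) assms(5) by simp
    show "k ` ball (h z) s \<subseteq> D" using s k(2) assms(3) by fastforce
    show "h (k \<zeta>) = \<zeta>" if "\<zeta> \<in> ball (h z) s" for \<zeta> using s that k(2) by force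
  qed
  then show ?thesis using that by blast
qed

lemma inverse_branch_deriv:
  assumes h: "h holomorphic_on D" "open D" and b: "inverse_branch h D z s \<phi>" and \<zeta>: "\<zeta> \<in> ball (h z) s"
  shows "deriv h (\<phi> \<zeta>) * deriv \<phi> \<zeta> = 1"
proof -
  note B = inverse_branchD[OF b]
  have "(h \<circ> \<phi> has_field_derivative deriv h (\<phi> \<zeta>) * deriv \<phi> \<zeta>) (at \<zeta>)"
    by (intro DERIV_chain holomorphic_derivI[OF h] holomorphic_derivI[OF B(1)] B \<zeta> open_ball)
  moreover have "((\<lambda>\<zeta>. \<zeta>) has_field_derivative 1) (at \<zeta>)" by simp
  then have "(h \<circ> \<phi> has_field_derivative 1) (at \<zeta>)"
    by (rule has_field_derivative_transform_within_open[OF _ open_ball \<zeta>]) (simp add: B)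
  ultimately show ?thesis using DERIV_unique by blast
qed

lemma inverse_branch_unique:
  assumes h: "h holomorphic_on D" "open D" "z \<in> D" and dh: "deriv h z \<noteq> 0"
    and b: "inverse_branch h D z s \<phi>" "inverse_branch h D z s \<psi>" and \<zeta>: "\<zeta> \<in> ball (h z) s"
  shows "\<phi> \<zeta> = \<psi> \<zeta>"
proof -
  note B = inverse_branchD[OF b(1)] and B' = inverse_branchD[OF b(2)]
  have s: "s > 0" using \<zeta> by (metis ball_eq_empty empty_iff not_le)
  obtain r where r: "r > 0" "ball z r \<subseteq> D" "inj_on h (ball z r)"
    using has_complex_derivative_locally_injective[OF h(1,3,2) dh] by metis
  define T where "T = {\<zeta> \<in> ball (h z) s. \<phi> \<zeta> \<in> ball z r} \<inter> {\<zeta> \<in> ball (h z) s. \<psi> \<zeta> \<in> ball z r}"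
  have "open T"
    unfolding T_def
    using continuous_open_preimage[OF holomorphic_on_imp_continuous_on[OF B(1)] open_ball open_ball, of z r]
      continuous_open_preimage[OF holomorphic_on_imp_continuous_on[OF B'(1)] open_ball open_ball, of z r]
    by (intro open_Int) (simp_all add: vimage_def Int_def)
  moreover have "h z \<in> T" using s r(1) B(4) B'(4) by (simp add: T_def)
  then have "T \<noteq> {}" by blast
  moreover have "T \<subseteq> ball (h z) s" by (auto simp: T_def)
  moreover have "\<phi> \<xi> = \<psi> \<xi>" if "\<xi> \<in> T" for \<xi>
    using that B(3)[of \<xi>] B'(3)[of \<xi>] r(3) by (auto simp: T_def inj_on_def)
  ultimately show ?thesis
    by (intro analytic_continuation_open[OF _ open_ball _ connected_ball _ B(1) B'(1) _ \<zeta>])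
qed

text \<open>
  On \<open>K\<close> the derivative of \<open>h\<close> is bounded away from 0, so \<open>\<phi>\<close> is Lipschitz and extends
  continuously to the closed disc, still as a right inverse of \<open>h\<close>. Thus \<open>h\<close> is injective on
  the compact image and then on a neighbourhood of it, whose image under \<open>h\<close> contains a larger
  disc.
\<close>

lemma inverse_branch_enlarge:
  assumes h: "h holomorphic_on D" "open D" and dh: "\<And>w. w \<in> D \<Longrightarrow> deriv h w \<noteq> 0"
    and b: "inverse_branch h D z s \<phi>" and "0 < s"
    and K: "compact K" "K \<subseteq> D" "\<phi> ` ball (h z) s \<subseteq> K"
  obtains s' \<psi> where "s < s'" "inverse_branch h D z s' \<psi>"
proof -
  note B = inverse_branchD[OF b]
  let ?U = "ball (h z) s" and ?V = "cball (h z) s"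
  have cont: "continuous_on K (\<lambda>w. inverse (norm (deriv h w)))"
    using dh K(2) holomorphic_on_imp_continuous_on[OF holomorphic_deriv[OF h]]
    by (intro continuous_intros) (auto intro: continuous_on_subset)
  then have "bounded ((\<lambda>w. inverse (norm (deriv h w))) ` K)"
    using K(1) compact_continuous_image compact_imp_bounded by blast
  then obtain L where L: "L > 0" "\<And>w. w \<in> K \<Longrightarrow> inverse (norm (deriv h w)) \<le> L"
    unfolding bounded_pos by auto
  have bound: "norm (deriv \<phi> \<zeta>) \<le> L" if "\<zeta> \<in> ?U" for \<zeta>
  proof -
    have "norm (deriv h (\<phi> \<zeta>)) * norm (deriv \<phi> \<zeta>) = 1"
      using inverse_branch_deriv[OF h b that] by (metis norm_mult norm_one)
    then have "norm (deriv \<phi> \<zeta>) = inverse (norm (deriv h (\<phi> \<zeta>)))"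
      by (metis inverse_unique)
    then show ?thesis using L(2)[of "\<phi> \<zeta>"] K(3) that by (simp add: image_subset_iff)
  qed
  have lip: "norm (\<phi> x - \<phi> y) \<le> L * norm (x - y)" if "x \<in> ?U" "y \<in> ?U" for x y
  proof (rule field_differentiable_bound[OF convex_ball _ bound that])
    show "(\<phi> has_field_derivative deriv \<phi> \<xi>) (at \<xi> within ?U)" if "\<xi> \<in> ?U" for \<xi>
      by (rule has_field_derivative_at_within[OF holomorphic_derivI[OF B(1) open_ball that]])
  qed
  have "uniformly_continuous_on ?U \<phi>"
    unfolding uniformly_continuous_on_def
  proof (intro allI impI)
    fix e :: real assume "e > 0"
    have "dist (\<phi> x') (\<phi> x) < e" if "x \<in> ?U" "x' \<in> ?U" "dist x' x < e / L" for x x'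
    proof -
      have "norm (\<phi> x' - \<phi> x) \<le> L * norm (x' - x)" using lip that by blast
      also have "\<dots> < e" using that(3) L(1) by (simp add: dist_norm field_simps)
      finally show ?thesis by (simp add: dist_norm)
    qed
    then show "\<exists>d>0. \<forall>x\<in>?U. \<forall>x'\<in>?U. dist x' x < d \<longrightarrow> dist (\<phi> x') (\<phi> x) < e"
      using \<open>e > 0\<close> L(1) by (intro exI[of _ "e / L"]) auto
  qed
  then obtain g where g: "uniformly_continuous_on (closure ?U) g" "\<And>x. x \<in> ?U \<Longrightarrow> \<phi> x = g x"
    using uniformly_continuous_on_extension_on_closure by metis
  have cl: "closure ?U = ?V" using \<open>0 < s\<close> by simp
  have cg: "continuous_on ?V g" using g(1) cl uniformly_continuous_imp_continuous by metis
  have gK: "g \<zeta> \<in> K" if "\<zeta> \<in> ?V" for \<zeta>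
  proof -
    have "g ` closure ?U \<subseteq> K"
      by (rule image_closure_subset) (use cg cl K g(2) compact_imp_closed in auto)
    then show ?thesis using that cl by auto
  qed
  have conth: "continuous_on D h" using h(1) by (rule holomorphic_on_imp_continuous_on)
  have "continuous_on ?V (\<lambda>\<zeta>. h (g \<zeta>))"
    by (rule continuous_on_compose2[OF conth cg]) (use gK K(2) in auto)
  then have chg: "continuous_on (closure ?U) (\<lambda>\<zeta>. h (g \<zeta>) - \<zeta>)"
    unfolding cl by (intro continuous_intros)
  have hg: "h (g \<zeta>) = \<zeta>" if "\<zeta> \<in> ?V" for \<zeta>
  proof -
    have "h (g \<zeta>) - \<zeta> = 0"
      by (rule continuous_constant_on_closure[OF chg]) (use B(3) g(2) cl that in auto)
    then show ?thesis by simp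
  qed
  obtain N where N: "open N" "g ` ?V \<subseteq> N" "N \<subseteq> D" "inj_on h N"
  proof (rule locally_injective_near_compact[OF conth h(2)])
    show "compact (g ` ?V)" using cg by (intro compact_continuous_image) auto
    show "g ` ?V \<subseteq> D" using gK K(2) by auto
    show "inj_on h (g ` ?V)" by (rule inj_onI) (use hg in auto)
    fix x assume "x \<in> g ` ?V"
    then have "x \<in> D" using gK K(2) by auto
    then obtain r where "r > 0" "inj_on h (ball x r)"
      using has_complex_derivative_locally_injective[OF h(1) _ h(2) dh] by metis
    then show "\<exists>r>0. inj_on h (ball x r)" by blast
  qed
  have op: "open (h ` N)"
    using open_mapping_thm3[OF holomorphic_on_subset[OF h(1) N(3)] N(1,4)] .
  have VN: "?V \<subseteq> h ` N" using hg N(2) by force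
  have "\<exists>e>0. (\<Union>x\<in>?V. ball x e) \<subseteq> h ` N"
    using compact_subset_open_imp_ball_epsilon_subset[OF compact_cball op VN] by metis
  then obtain e where e: "e > 0" "(\<Union>x\<in>?V. ball x e) \<subseteq> h ` N" by blast
  have sub: "ball (h z) (s + e) \<subseteq> h ` N"
  proof
    fix y assume y: "y \<in> ball (h z) (s + e)"
    show "y \<in> h ` N"
    proof (cases "y \<in> ?V")
      case True then show ?thesis using VN by blast
    next
      case False
      \<comment> \<open>The radial projection of \<open>y\<close> to the circle of radius \<open>s\<close>.\<close>
      define x where "x = h z + of_real (s / norm (y - h z)) * (y - h z)"
      have n: "s < norm (y - h z)" "norm (y - h z) < s + e"
        using y False by (auto simp: dist_norm norm_minus_commute)
      have "y \<noteq> h z" using n(1) \<open>0 < s\<close> by auto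
      then have "norm (x - h z) = s"
        using n \<open>0 < s\<close> by (simp add: x_def norm_mult norm_divide)
      then have "x \<in> ?V" by (simp add: dist_norm norm_minus_commute)
      have "y - x = of_real (1 - s / norm (y - h z)) * (y - h z)"
        by (simp add: x_def algebra_simps)
      then have "norm (y - x) = \<bar>1 - s / norm (y - h z)\<bar> * norm (y - h z)"
        by (simp only: norm_mult norm_of_real)
      also have "\<dots> = (1 - s / norm (y - h z)) * norm (y - h z)"
      proof -
        have "s / norm (y - h z) < 1" using n(1) \<open>0 < s\<close> by (simp add: divide_less_eq)
        then show ?thesis by simp
      qed
      also have "\<dots> = norm (y - h z) - s"
        using \<open>y \<noteq> h z\<close> by (simp add: field_simps)
      finally have "y \<in> ball x e" using n by (simp add: dist_norm norm_minus_commute)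
      then show ?thesis using e(2) \<open>x \<in> ?V\<close> by blast
    qed
  qed
  have "z \<in> N" using N(2) g(2)[of "h z"] B(4) \<open>0 < s\<close> by force
  obtain \<psi> where "inverse_branch h D z (s + e) \<psi>"
    using inverse_branch_from_injective[OF h(1) N(1,3,4) \<open>z \<in> N\<close> sub] .
  then show ?thesis using that e(1) by force
qed

text \<open>
  A continuity argument on the radius: branches agree on common discs, so they glue to one on
  the largest radius, and below \<open>R\<close> the branch could be enlarged. The sets \<open>K s\<close> keep the
  values of the branch away from the boundary of \<open>D\<close>.
\<close>

lemma inverse_branch_extends:
  assumes h: "h holomorphic_on D" "open D" "z \<in> D" and dh: "\<And>w. w \<in> D \<Longrightarrow> deriv h w \<noteq> 0" and "0 < R"
    and K: "\<And>s. s < R \<Longrightarrow> compact (K s) \<and> K s \<subseteq> D"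
    and trap: "\<And>s \<phi>. 0 < s \<Longrightarrow> s < R \<Longrightarrow> inverse_branch h D z s \<phi> \<Longrightarrow> \<phi> ` ball (h z) s \<subseteq> K s"
  obtains \<phi> where "inverse_branch h D z R \<phi>"
proof -
  define \<Sigma> where "\<Sigma> = {s. 0 < s \<and> s \<le> R \<and> (\<exists>\<phi>. inverse_branch h D z s \<phi>)}"
  obtain r where r: "r > 0" "ball z r \<subseteq> D" "open (h ` ball z r)" "inj_on h (ball z r)"
    using has_complex_derivative_locally_invertible[OF h(1,3,2) dh[OF h(3)]] by metis
  then obtain e where e: "e > 0" "ball (h z) e \<subseteq> h ` ball z r"
    by (metis centre_in_ball image_eqI open_contains_ball)
  obtain k where "inverse_branch h D z e k"
    using inverse_branch_from_injective[OF h(1) open_ball r(2,4) _ e(2)] r(1) by auto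
  then have "min e R \<in> \<Sigma>"
    using e(1) \<open>0 < R\<close> inverse_branch_subset[of h D z e k "min e R"] by (auto simp: \<Sigma>_def)
  then have ne: "\<Sigma> \<noteq> {}" by blast
  have bdd: "bdd_above \<Sigma>" by (auto simp: \<Sigma>_def bdd_above_def)
  define t where "t = Sup \<Sigma>"
  have t: "0 < t" "t \<le> R"
    using cSup_upper[OF \<open>min e R \<in> \<Sigma>\<close> bdd] cSup_least[OF ne, of R] e(1) \<open>0 < R\<close>
    by (auto simp: t_def \<Sigma>_def)
  obtain br where br: "\<And>s. s \<in> \<Sigma> \<Longrightarrow> inverse_branch h D z s (br s)"
    unfolding \<Sigma>_def by atomize_elim (rule choice, auto)
  define rad where "rad \<zeta> = (SOME s. s \<in> \<Sigma> \<and> \<zeta> \<in> ball (h z) s)" for \<zeta>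
  define \<Phi> where "\<Phi> \<zeta> = br (rad \<zeta>) \<zeta>" for \<zeta>
  have rad: "rad \<zeta> \<in> \<Sigma> \<and> \<zeta> \<in> ball (h z) (rad \<zeta>)" if "\<zeta> \<in> ball (h z) t" for \<zeta>
  proof -
    have "dist (h z) \<zeta> < Sup \<Sigma>" using that by (simp add: t_def)
    then obtain s where "s \<in> \<Sigma>" "dist (h z) \<zeta> < s"
      using less_cSup_iff[OF ne bdd, of "dist (h z) \<zeta>"] by blast
    then show ?thesis unfolding rad_def by (intro someI[of "\<lambda>s. s \<in> \<Sigma> \<and> \<zeta> \<in> ball (h z) s" s]) simp
  qed
  have \<Phi>_eq: "\<Phi> \<xi> = br s \<xi>" if "s \<in> \<Sigma>" "\<xi> \<in> ball (h z) s" for s \<xi>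
  proof -
    have "s \<le> t" unfolding t_def by (rule cSup_upper[OF that(1) bdd])
    then have R: "rad \<xi> \<in> \<Sigma>" "\<xi> \<in> ball (h z) (rad \<xi>)" using rad[of \<xi>] that(2) by auto
    let ?m = "min s (rad \<xi>)"
    have "inverse_branch h D z ?m (br s)" "inverse_branch h D z ?m (br (rad \<xi>))"
      using inverse_branch_subset[OF br[OF that(1)], of ?m] inverse_branch_subset[OF br[OF R(1)], of ?m]
      by simp_all
    then show ?thesis
      unfolding \<Phi>_def using inverse_branch_unique[OF h dh[OF h(3)], of ?m "br (rad \<xi>)" "br s" \<xi>] that R by simp
  qed
  have bt: "inverse_branch h D z t \<Phi>"
    unfolding inverse_branch_def
  proof (intro conjI ballI)
    show "\<Phi> ` ball (h z) t \<subseteq> D"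
      using rad inverse_branchD(2)[OF br] unfolding \<Phi>_def by blast
    show "h (\<Phi> \<zeta>) = \<zeta>" if "\<zeta> \<in> ball (h z) t" for \<zeta>
      using rad[OF that] inverse_branchD(3)[OF br] unfolding \<Phi>_def by blast
    show "\<Phi> (h z) = z"
      using rad[of "h z"] t(1) inverse_branchD(4)[OF br] unfolding \<Phi>_def by auto
    have "\<Phi> field_differentiable (at \<zeta>)" if z: "\<zeta> \<in> ball (h z) t" for \<zeta>
    proof -
      have R: "rad \<zeta> \<in> \<Sigma>" "\<zeta> \<in> ball (h z) (rad \<zeta>)" using rad[OF z] by auto
      have "(br (rad \<zeta>) has_field_derivative deriv (br (rad \<zeta>)) \<zeta>) (at \<zeta>)"
        by (rule holomorphic_derivI[OF inverse_branchD(1)[OF br[OF R(1)]] open_ball R(2)])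
      then have "(\<Phi> has_field_derivative deriv (br (rad \<zeta>)) \<zeta>) (at \<zeta>)"
        by (rule has_field_derivative_transform_within_open[OF _ open_ball R(2)]) (simp add: \<Phi>_eq[OF R(1)])
      then show ?thesis unfolding field_differentiable_def by blast
    qed
    then show "\<Phi> holomorphic_on ball (h z) t"
      by (simp add: holomorphic_on_def field_differentiable_at_within)
  qed
  have "t = R"
  proof (rule ccontr)
    assume "t \<noteq> R"
    then have "t < R" using t(2) by simp
    then obtain s' \<psi> where s': "t < s'" "inverse_branch h D z s' \<psi>"
      using inverse_branch_enlarge[OF h(1,2) dh bt t(1) _ _ trap[OF t(1) _ bt]] K by metis
    have "min s' R \<in> \<Sigma>"
      using inverse_branch_subset[OF s'(2), of "min s' R"] s'(1) t(1) \<open>0 < R\<close> by (auto simp: \<Sigma>_def)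
    then have "min s' R \<le> t" unfolding t_def using bdd by (rule cSup_upper)
    then show False using s'(1) \<open>t < R\<close> by auto
  qed
  then show ?thesis using that bt by blast
qed

text \<open>
  Along an inverse branch \<open>\<phi>\<close> of \<open>h\<close> one has \<open>F (\<phi> \<zeta>) = \<zeta> + cnj (g (\<phi> \<zeta>))\<close>, and \<open>g \<circ> \<phi>\<close> is
  1-Lipschitz because \<open>g'\<close> is dominated by \<open>h'\<close>. Hence \<open>F \<circ> \<phi>\<close> moves points by at most
  \<open>2 |\<zeta> - h z|\<close>, which confines \<open>\<phi>\<close> to compact sets for radii below \<open>R / 2\<close>. The branch on the
  disc of radius \<open>R / 2\<close> is univalent and omits \<open>w\<close>.
\<close>

lemma dominant_part_deriv_lower_bound:
  assumes h: "h holomorphic_on D" and g: "g holomorphic_on D" and D: "open D" "z \<in> D"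
    and dom: "\<And>w. w \<in> D \<Longrightarrow> norm (deriv g w) < norm (deriv h w)"
    and F: "\<And>w. w \<in> D \<Longrightarrow> F w = h w + cnj (g w)" and inj: "inj_on F D"
    and R: "0 < R" "ball (F z) R \<subseteq> F ` D" and w: "w \<notin> D"
  shows "R \<le> 4 * omit_const * norm (deriv h z) * norm (w - z)"
proof -
  have "continuous_on D (\<lambda>w. h w + cnj (g w))"
    by (intro continuous_intros holomorphic_on_imp_continuous_on h g)
  then have cF: "continuous_on D F" by (rule continuous_on_eq) (simp add: F)
  obtain k where "homeomorphism D (F ` D) F k"
    using invariance_of_domain_homeomorphism[OF D(1) cF _ inj] by auto
  then have k: "continuous_on (F ` D) k" "\<And>x. x \<in> D \<Longrightarrow> k (F x) = x" "k ` (F ` D) = D"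
    by (auto simp: homeomorphism_def)
  have dh: "deriv h w \<noteq> 0" if "w \<in> D" for w using dom[OF that] by auto
  define K where "K s = k ` cball (F z) (2 * s)" for s
  have sub: "cball (F z) (2 * s) \<subseteq> F ` D" if "s < R / 2" for s
    using that R(2) by (auto intro!: subsetD[OF R(2)])
  obtain \<phi> where \<phi>: "inverse_branch h D z (R / 2) \<phi>"
  proof (rule inverse_branch_extends[OF h D dh, of "R / 2" K])
    show "0 < R / 2" using R by simp
    show "compact (K s) \<and> K s \<subseteq> D" if "s < R / 2" for s
    proof
      show "compact (K s)"
        unfolding K_def
        by (rule compact_continuous_image[OF continuous_on_subset[OF k(1) sub[OF that]] compact_cball])
      show "K s \<subseteq> D"
        unfolding K_def using image_mono[OF sub[OF that], of k] unfolding k(3) .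
    qed
    fix s \<phi> assume s: "0 < s" "s < R / 2" and b: "inverse_branch h D z s \<phi>"
    note B = inverse_branchD[OF b]
    show "\<phi> ` ball (h z) s \<subseteq> K s"
    proof
      fix p assume "p \<in> \<phi> ` ball (h z) s"
      then obtain \<zeta> where \<zeta>: "\<zeta> \<in> ball (h z) s" "p = \<phi> \<zeta>" by blast
      have "norm ((g \<circ> \<phi>) \<zeta> - (g \<circ> \<phi>) (h z)) \<le> 1 * norm (\<zeta> - h z)"
      proof (rule field_differentiable_bound[OF convex_ball _ _ \<zeta>(1),
            where f' = "\<lambda>\<xi>. deriv g (\<phi> \<xi>) * deriv \<phi> \<xi>"])
        fix \<xi> assume \<xi>: "\<xi> \<in> ball (h z) s"
        show "(g \<circ> \<phi> has_field_derivative deriv g (\<phi> \<xi>) * deriv \<phi> \<xi>) (at \<xi> within ball (h z) s)"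
          by (intro has_field_derivative_at_within[OF DERIV_chain]
              holomorphic_derivI[OF g D(1) B(2)[OF \<xi>]] holomorphic_derivI[OF B(1) open_ball \<xi>])
        have "norm (deriv g (\<phi> \<xi>) * deriv \<phi> \<xi>) \<le> norm (deriv h (\<phi> \<xi>) * deriv \<phi> \<xi>)"
          using dom[OF B(2)[OF \<xi>]] by (simp add: norm_mult mult_right_mono)
        then show "norm (deriv g (\<phi> \<xi>) * deriv \<phi> \<xi>) \<le> 1"
          using inverse_branch_deriv[OF h D(1) b \<xi>] by simp
      qed (use s in simp)
      then have "norm (g (\<phi> \<zeta>) - g z) \<le> norm (\<zeta> - h z)" using B(4) by simp
      moreover have "F p - F z = (\<zeta> - h z) + cnj (g (\<phi> \<zeta>) - g z)"
        using F[OF B(2)[OF \<zeta>(1)]] F[OF D(2)] B(3)[OF \<zeta>(1)] \<zeta>(2) by simp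
      then have "norm (F p - F z) \<le> norm (\<zeta> - h z) + norm (g (\<phi> \<zeta>) - g z)"
        by (metis complex_mod_cnj norm_triangle_ineq)
      ultimately have "F p \<in> cball (F z) (2 * s)"
        using \<zeta>(1) by (simp add: dist_norm norm_minus_commute)
      then show "p \<in> K s"
        unfolding K_def using k(2)[of p] B(2)[OF \<zeta>(1)] \<zeta>(2) by (metis image_eqI)
    qed
  qed auto
  note B = inverse_branchD[OF \<phi>]
  have "inj_on \<phi> (ball (h z) (R / 2))" using B(3) by (metis inj_onI)
  moreover have "w \<notin> \<phi> ` ball (h z) (R / 2)" using w B(2) by blast
  ultimately have "R / 2 * norm (deriv \<phi> (h z)) \<le> 2 * omit_const * norm (w - \<phi> (h z))"
    using weak_Koebe[OF B(1)] R(1) by simp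
  moreover have "norm (deriv h z) * norm (deriv \<phi> (h z)) = 1"
    using inverse_branch_deriv[OF h D(1) \<phi>, of "h z"] R(1) B(4) by (simp flip: norm_mult)
  then have "norm (deriv \<phi> (h z)) = inverse (norm (deriv h z))"
    by (metis inverse_unique)
  ultimately show ?thesis
    using dh[OF D(2)] B(4) by (simp add: field_simps)
qed

section \<open>An upper bound for the boundary distance of the image\<close>

lemma ball_infdist_frontier_subset:
  fixes S :: "'a::real_normed_vector set"
  assumes "w \<in> S"
  shows "ball w (infdist w (frontier S)) \<subseteq> S"
proof
  fix y assume y: "y \<in> ball w (infdist w (frontier S))"
  show "y \<in> S"
  proof (rule ccontr)
    assume "y \<notin> S"
    have "w \<in> ball w (infdist w (frontier S))"
      using y by (metis ball_eq_empty centre_in_ball empty_iff not_le)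
    then have "ball w (infdist w (frontier S)) \<inter> frontier S \<noteq> {}"
      using connected_Int_frontier[OF connected_ball, of w "infdist w (frontier S)" S] assms y \<open>y \<notin> S\<close>
      by blast
    then obtain q where "q \<in> frontier S" "dist w q < infdist w (frontier S)"
      by auto
    then show False using infdist_le[of q "frontier S" w] by simp
  qed
qed

text \<open>
  The difference of the moduli of \<open>h'\<close> and \<open>g'\<close> is continuous and by Lewy's theorem nowhere 0,
  so it has a constant sign on the connected \<open>D\<close>. If \<open>g'\<close> dominates, the conjugate of \<open>f\<close>
  takes the place of \<open>f\<close>.
\<close>

lemma harmonic_univalent_Lambda_lower_bound:
  assumes h: "h holomorphic_on D" and g: "g holomorphic_on D" and D: "open D" "connected D" "z \<in> D"
    and f: "\<And>w. w \<in> D \<Longrightarrow> f w = h w + cnj (g w)" and inj: "inj_on f D"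
    and R: "0 < R" "ball (f z) R \<subseteq> f ` D" and w: "w \<notin> D"
  shows "R \<le> 4 * omit_const * Lambda f z * norm (w - z)"
proof -
  have L: "Lambda f z = norm (deriv h z) + norm (deriv g z)"
    by (rule Lambda_harmonic_sum[OF h g D(1,3) f])
  have oc: "omit_const > 0" by (simp add: omit_const_def)
  have inj': "inj_on (\<lambda>z. h z + cnj (g z)) D"
    using inj f by (auto simp: inj_on_def)
  have ne: "norm (deriv h x) - norm (deriv g x) \<noteq> 0" if "x \<in> D" for x
    using Lewy[OF h g D(1,2) that inj'] by simp
  have cont: "continuous_on D (\<lambda>x. norm (deriv h x) - norm (deriv g x))"
    by (intro continuous_intros holomorphic_on_imp_continuous_on holomorphic_deriv h g D)
  have conn: "connected ((\<lambda>x. norm (deriv h x) - norm (deriv g x)) ` D)"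
    using cont D(2) by (rule connected_continuous_image)
  have "(\<forall>x\<in>D. norm (deriv g x) < norm (deriv h x)) \<or> (\<forall>x\<in>D. norm (deriv h x) < norm (deriv g x))"
  proof (rule ccontr)
    assume "\<not> ?thesis"
    then obtain x y where xy: "x \<in> D" "y \<in> D" "norm (deriv h x) - norm (deriv g x) \<le> 0"
      "0 \<le> norm (deriv h y) - norm (deriv g y)"
      by (auto simp: not_less)
    then have "0 \<in> (\<lambda>x. norm (deriv h x) - norm (deriv g x)) ` D"
      by (intro connectedD_interval[OF conn imageI imageI])
    then show False using ne by auto
  qed
  then show ?thesis
  proof
    assume dom: "\<forall>x\<in>D. norm (deriv g x) < norm (deriv h x)"
    have "R \<le> 4 * omit_const * norm (deriv h z) * norm (w - z)"
      using dominant_part_deriv_lower_bound[OF h g D(1,3) _ f inj R w] dom by blast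
    also have "\<dots> \<le> 4 * omit_const * Lambda f z * norm (w - z)"
      using oc by (intro mult_right_mono mult_left_mono) (auto simp: L)
    finally show ?thesis .
  next
    assume dom: "\<forall>x\<in>D. norm (deriv h x) < norm (deriv g x)"
    have "R \<le> 4 * omit_const * norm (deriv g z) * norm (w - z)"
    proof (rule dominant_part_deriv_lower_bound[OF g h D(1,3) _ _ _ R(1) _ w, where F = "\<lambda>x. cnj (f x)"])
      show "inj_on (\<lambda>x. cnj (f x)) D" using inj by (simp add: inj_on_def)
      show "ball (cnj (f z)) R \<subseteq> (\<lambda>x. cnj (f x)) ` D"
      proof
        fix y assume "y \<in> ball (cnj (f z)) R"
        then have "cnj y \<in> ball (f z) R"
          by (metis complex_cnj_cnj complex_cnj_diff complex_mod_cnj dist_norm mem_ball)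
        then obtain x where "x \<in> D" "cnj y = f x" using R(2) by blast
        then show "y \<in> (\<lambda>x. cnj (f x)) ` D" by (metis complex_cnj_cnj image_eqI)
      qed
    qed (use dom f in auto)
    also have "\<dots> \<le> 4 * omit_const * Lambda f z * norm (w - z)"
      using oc by (intro mult_right_mono mult_left_mono) (auto simp: L)
    finally show ?thesis .
  qed
qed

lemma harmonic_univalent_distance_bound:
  assumes h: "h holomorphic_on D" and g: "g holomorphic_on D" and D: "open D" "connected D" "z \<in> D"
    and fr: "frontier D \<noteq> {}"
    and f: "\<And>w. w \<in> D \<Longrightarrow> f w = h w + cnj (g w)" and inj: "inj_on f D"
  shows "1 / (4 * omit_const) * infdist (f z) (frontier (f ` D)) \<le> infdist z (frontier D) * Lambda f z"
proof -
  have L: "0 \<le> Lambda f z"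
    using Lambda_harmonic_sum[OF h g D(1,3) f] by simp
  have oc: "omit_const > 0" by (simp add: omit_const_def)
  obtain w where w: "w \<in> frontier D" "infdist z (frontier D) = dist z w"
    using infdist_attains_inf[OF frontier_closed fr] by metis
  have wD: "w \<notin> D" using w(1) D(1) by (simp add: frontier_def interior_open)
  let ?R = "infdist (f z) (frontier (f ` D))"
  show ?thesis
  proof (cases "?R = 0")
    case True
    then show ?thesis using L infdist_nonneg[of z "frontier D"] by simp
  next
    case False
    then have R: "0 < ?R" using infdist_nonneg[of "f z" "frontier (f ` D)"] by simp
    have "ball (f z) ?R \<subseteq> f ` D"
      using D(3) by (intro ball_infdist_frontier_subset) blast
    from harmonic_univalent_Lambda_lower_bound[OF h g D f inj R this wD]
    have "?R \<le> 4 * omit_const * Lambda f z * norm (w - z)" .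
    then show ?thesis
      using oc w(2) by (simp add: dist_norm norm_minus_commute field_simps)
  qed
qed

section \<open>Deviation of a Hoelder smooth Jordan curve from its tangents\<close>

lemma Hoelder_imp_continuous_on:
  fixes f :: "real \<Rightarrow> 'a::metric_space"
  assumes "0 < \<alpha>" and L: "\<And>s t. dist (f s) (f t) \<le> L * \<bar>s - t\<bar> powr \<alpha>"
  shows "continuous_on UNIV f"
proof -
  have "(f \<longlongrightarrow> f x) (at x)" for x
  proof -
    have "((\<lambda>y. L * \<bar>y - x\<bar> powr \<alpha>) \<longlongrightarrow> L * \<bar>x - x\<bar> powr \<alpha>) (at x)"
      using assms(1) by (intro tendsto_intros tendsto_powr') auto
    then have "((\<lambda>y. L * \<bar>y - x\<bar> powr \<alpha>) \<longlongrightarrow> 0) (at x)" by simp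
    then have "((\<lambda>y. dist (f y) (f x)) \<longlongrightarrow> 0) (at x)"
      by (rule tendsto_sandwich[OF _ _ tendsto_const, rotated 2])
        (use L in \<open>auto intro!: always_eventually\<close>)
    then show ?thesis using tendsto_dist_iff by blast
  qed
  then show ?thesis by (simp add: continuous_on_def)
qed

lemma C1_Hoelder_taylor:
  fixes \<gamma> :: "real \<Rightarrow> 'a::real_normed_vector"
  assumes der: "\<And>t. (\<gamma> has_vector_derivative \<gamma>' t) (at t)" and "0 \<le> \<alpha>" "0 \<le> L"
    and L: "\<And>s t. norm (\<gamma>' s - \<gamma>' t) \<le> L * \<bar>s - t\<bar> powr \<alpha>"
  shows "norm (\<gamma> t - \<gamma> s - (t - s) *\<^sub>R \<gamma>' s) \<le> L * \<bar>t - s\<bar> powr (1 + \<alpha>)"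
proof -
  have "norm (\<gamma> t - \<gamma> s - (t - s) *\<^sub>R \<gamma>' s) \<le> norm (t - s) * (L * \<bar>t - s\<bar> powr \<alpha>)"
  proof (rule vector_differentiable_bound_linearization[where S = "closed_segment s t"])
    show "(\<gamma> has_vector_derivative \<gamma>' x) (at x within closed_segment s t)" for x
      using der by (rule has_vector_derivative_at_within)
    fix x assume "x \<in> closed_segment s t"
    then have "\<bar>x - s\<bar> \<le> \<bar>t - s\<bar>" by (auto simp: closed_segment_eq_real_ivl split: if_splits)
    then have "L * \<bar>x - s\<bar> powr \<alpha> \<le> L * \<bar>t - s\<bar> powr \<alpha>"
      using assms(2,3) by (intro mult_left_mono powr_mono2) auto
    then show "norm (\<gamma>' x - \<gamma>' s) \<le> L * \<bar>t - s\<bar> powr \<alpha>"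
      using L[of x s] by linarith
  qed auto
  also have "\<dots> = L * \<bar>t - s\<bar> powr (1 + \<alpha>)"
    by (cases "t = s") (simp_all add: powr_add)
  finally show ?thesis .
qed

text \<open>
  Simplicity speaks about the parameter interval \<open>[0, 1]\<close> only; periodicity lets the chord
  estimates compare parameters across the base point.
\<close>

lemma periodic_simple_path_inj:
  fixes \<gamma> :: "real \<Rightarrow> complex"
  assumes per: "\<And>t. \<gamma> (t + 1) = \<gamma> t" and sp: "simple_path \<gamma>"
    and s: "0 \<le> s" "s \<le> 1" and st: "\<bar>t - s\<bar> \<le> 1/2" and eq: "\<gamma> s = \<gamma> t"
  shows "s = t"
proof -
  have lf: "x = y \<or> x = 0 \<and> y = 1 \<or> x = 1 \<and> y = 0"
    if "0 \<le> x" "x \<le> 1" "0 \<le> y" "y \<le> 1" "\<gamma> x = \<gamma> y" for x y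
    using sp that by (auto simp: simple_path_def loop_free_def)
  consider "t < 0" | "0 \<le> t" "t \<le> 1" | "1 < t" by linarith
  then show ?thesis
  proof cases
    case 1
    have "s = t + 1 \<or> s = 0 \<and> t + 1 = 1 \<or> s = 1 \<and> t + 1 = 0"
      using 1 s st eq per[of t] by (intro lf) (auto simp: abs_if split: if_splits)
    then show ?thesis using 1 st by auto
  next
    case 2
    have "s = t \<or> s = 0 \<and> t = 1 \<or> s = 1 \<and> t = 0"
      using 2 s eq by (intro lf) auto
    then show ?thesis using st by auto
  next
    case 3
    have "s = t - 1 \<or> s = 0 \<and> t - 1 = 1 \<or> s = 1 \<and> t - 1 = 0"
      using 3 s st eq per[of "t - 1"] by (intro lf) (auto simp: abs_if split: if_splits)
    then show ?thesis using 3 st by auto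
  qed
qed

lemma nearest_point_orthogonal_tangent:
  fixes \<gamma> :: "real \<Rightarrow> 'a::real_inner"
  assumes der: "(\<gamma> has_vector_derivative v) (at t0)"
    and min: "\<And>t. dist z (\<gamma> t0) \<le> dist z (\<gamma> t)"
  shows "inner (z - \<gamma> t0) v = 0"
proof -
  have "((\<lambda>t. inner (z - \<gamma> t) (z - \<gamma> t)) has_derivative
      (\<lambda>h. inner (z - \<gamma> t0) (0 - h *\<^sub>R v) + inner (0 - h *\<^sub>R v) (z - \<gamma> t0))) (at t0)"
    using der unfolding has_vector_derivative_def
    by (intro derivative_intros)
  then have "((\<lambda>t. inner (z - \<gamma> t) (z - \<gamma> t)) has_real_derivative (- 2 * inner (z - \<gamma> t0) v)) (at t0)"
    unfolding has_field_derivative_def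
    by (rule has_derivative_eq_rhs) (auto simp: fun_eq_iff inner_commute)
  moreover have "\<forall>t. \<bar>t0 - t\<bar> < 1 \<longrightarrow> inner (z - \<gamma> t0) (z - \<gamma> t0) \<le> inner (z - \<gamma> t) (z - \<gamma> t)"
    using min by (simp add: dist_norm norm_le)
  ultimately have "- 2 * inner (z - \<gamma> t0) v = 0"
    by (rule DERIV_local_min[of "\<lambda>t. inner (z - \<gamma> t) (z - \<gamma> t)" _ t0 1, OF _ zero_less_one])
  then show ?thesis by simp
qed

text \<open>
  At a nearest point \<open>p\<close> of the curve \<open>z - p\<close> is normal to the tangent, so only the Taylor
  remainder of order \<open>1 + \<alpha>\<close> in the parameter contributes to the inner product. The parameter
  distance is comparable with \<open>|q - p|\<close> when \<open>|q - p|\<close> is small: for close parameters by the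
  derivative, and parameters farther apart give points at least \<open>\<mu>\<close> apart, by compactness.
\<close>

lemma C1_Hoelder_curve_normal_deviation:
  assumes curve: "C1_Hoelder_Jordan_curve \<alpha> \<Gamma>" and \<alpha>: "0 < \<alpha>"
  obtains M \<rho> where "0 \<le> M" "0 < \<rho>"
    "\<And>z p q. p \<in> \<Gamma> \<Longrightarrow> (\<And>x. x \<in> \<Gamma> \<Longrightarrow> dist z p \<le> dist z x) \<Longrightarrow> q \<in> \<Gamma> \<Longrightarrow> norm (q - p) \<le> \<rho> \<Longrightarrow>
       \<bar>inner (z - p) (q - p)\<bar> \<le> norm (z - p) * (M * norm (q - p) powr (1 + \<alpha>))"
proof -
  obtain \<gamma> \<gamma>' L0 where per: "\<And>t. \<gamma> (t + 1) = \<gamma> t" and sp: "simple_path \<gamma>" and im: "path_image \<gamma> = \<Gamma>"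
    and der: "\<And>t. (\<gamma> has_vector_derivative \<gamma>' t) (at t)" and nz: "\<And>t. \<gamma>' t \<noteq> 0"
    and L0: "\<And>s t. norm (\<gamma>' s - \<gamma>' t) \<le> L0 * \<bar>s - t\<bar> powr \<alpha>"
    using curve unfolding C1_Hoelder_Jordan_curve_def by metis
  define L where "L = max L0 1"
  have L: "norm (\<gamma>' s - \<gamma>' t) \<le> L * \<bar>s - t\<bar> powr \<alpha>" for s t
  proof -
    have "L0 * \<bar>s - t\<bar> powr \<alpha> \<le> L * \<bar>s - t\<bar> powr \<alpha>" unfolding L_def by (intro mult_right_mono) auto
    then show ?thesis using L0[of s t] by linarith
  qed
  have Lpos: "0 < L" by (simp add: L_def)
  have taylor: "norm (\<gamma> t - \<gamma> s - (t - s) *\<^sub>R \<gamma>' s) \<le> L * \<bar>t - s\<bar> powr (1 + \<alpha>)" for s t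
    using C1_Hoelder_taylor[OF der _ _ L] \<alpha> Lpos by simp
  have c\<gamma>': "continuous_on UNIV \<gamma>'"
    by (rule Hoelder_imp_continuous_on[OF \<alpha>, of _ L]) (simp add: dist_norm L)
  have c\<gamma>: "continuous_on A \<gamma>" for A
    using der by (metis continuous_at_imp_continuous_on has_vector_derivative_continuous)
  have "continuous_on {0..1::real} (\<lambda>t. norm (\<gamma>' t))"
    by (intro continuous_intros continuous_on_subset[OF c\<gamma>']) auto
  then obtain tm where tm: "tm \<in> {0..1}" "\<And>t. t \<in> {0..1} \<Longrightarrow> norm (\<gamma>' tm) \<le> norm (\<gamma>' t)"
    using continuous_attains_inf[of "{0..1::real}" "\<lambda>t. norm (\<gamma>' t)"] by auto
  define m where "m = norm (\<gamma>' tm)"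
  have m: "0 < m" using nz by (simp add: m_def)
  \<comment> \<open>Chosen so that \<open>L * \<delta> powr \<alpha> = m / 2\<close>: up to \<open>\<delta>\<close> the Taylor remainder costs at
    most half of the speed.\<close>
  define \<delta> where "\<delta> = (m / (2 * L)) powr (1 / \<alpha>)"
  have \<delta>: "0 < \<delta>" using m Lpos by (simp add: \<delta>_def)
  have chord: "m / 2 * \<bar>t - s\<bar> \<le> norm (\<gamma> t - \<gamma> s)" if s: "s \<in> {0..1}" and ts: "\<bar>t - s\<bar> \<le> \<delta>" for s t
  proof -
    have "\<bar>t - s\<bar> powr \<alpha> \<le> \<delta> powr \<alpha>" using ts \<alpha> by (intro powr_mono2) auto
    also have "\<dots> = m / (2 * L)" using \<alpha> m Lpos by (simp add: \<delta>_def powr_powr)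
    finally have "L * \<bar>t - s\<bar> powr \<alpha> \<le> m / 2" using Lpos by (simp add: field_simps)
    then have "\<bar>t - s\<bar> * (L * \<bar>t - s\<bar> powr \<alpha>) \<le> \<bar>t - s\<bar> * (m / 2)" by (intro mult_left_mono) auto
    moreover have "\<bar>t - s\<bar> powr (1 + \<alpha>) = \<bar>t - s\<bar> * \<bar>t - s\<bar> powr \<alpha>"
      by (cases "t = s") (simp_all add: powr_add)
    ultimately have "L * \<bar>t - s\<bar> powr (1 + \<alpha>) \<le> m / 2 * \<bar>t - s\<bar>" by (simp add: mult_ac)
    moreover have "m * \<bar>t - s\<bar> \<le> norm ((t - s) *\<^sub>R \<gamma>' s)"
      using mult_right_mono[OF tm(2)[OF s], of "\<bar>t - s\<bar>"] by (simp add: m_def mult.commute)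
    moreover have "norm ((t - s) *\<^sub>R \<gamma>' s) \<le> norm (\<gamma> t - \<gamma> s) + norm (\<gamma> t - \<gamma> s - (t - s) *\<^sub>R \<gamma>' s)"
      using norm_triangle_ineq4[of "\<gamma> t - \<gamma> s" "\<gamma> t - \<gamma> s - (t - s) *\<^sub>R \<gamma>' s"] by simp
    ultimately show ?thesis using taylor[of t s] by (simp add: field_simps)
  qed
  \<comment> \<open>Pairs of parameters that are neither close nor equivalent modulo the period.\<close>
  define Q where "Q = ({0..1} \<times> {-1..2::real}) \<inter> {x. \<delta> \<le> \<bar>snd x - fst x\<bar>} \<inter> {x. \<bar>snd x - fst x\<bar> \<le> 1/2}"
  have "compact Q"
    unfolding Q_def Int_assoc
    by (intro compact_Int_closed compact_Times compact_Icc closed_Int closed_Collect_le continuous_intros)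
  obtain \<mu> where \<mu>: "0 < \<mu>" "\<And>s t. (s, t) \<in> Q \<Longrightarrow> \<mu> \<le> norm (\<gamma> t - \<gamma> s)"
  proof (cases "Q = {}")
    case True
    then show ?thesis using that[of 1] by auto
  next
    case False
    have "continuous_on Q (\<lambda>x. norm (\<gamma> (snd x) - \<gamma> (fst x)))"
      by (intro continuous_intros continuous_on_compose2[OF c\<gamma>[of UNIV]]) auto
    then obtain x where x: "x \<in> Q" "\<And>y. y \<in> Q \<Longrightarrow> norm (\<gamma> (snd x) - \<gamma> (fst x)) \<le> norm (\<gamma> (snd y) - \<gamma> (fst y))"
      using continuous_attains_inf[OF \<open>compact Q\<close> False] by blast
    have "\<gamma> (fst x) \<noteq> \<gamma> (snd x)"
      using periodic_simple_path_inj[OF per sp, of "fst x" "snd x"] x(1) \<delta> by (auto simp: Q_def)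
    then show ?thesis
      using x(2) by (intro that[of "norm (\<gamma> (snd x) - \<gamma> (fst x))"]) auto
  qed
  show ?thesis
  proof (rule that[of "L * (2 / m) powr (1 + \<alpha>)" "\<mu> / 2"])
    show "0 \<le> L * (2 / m) powr (1 + \<alpha>)" "0 < \<mu> / 2" using Lpos \<mu> by auto
    fix z p q
    assume p: "p \<in> \<Gamma>" and near: "\<And>x. x \<in> \<Gamma> \<Longrightarrow> dist z p \<le> dist z x" and q: "q \<in> \<Gamma>"
      and pq: "norm (q - p) \<le> \<mu> / 2"
    obtain t0 where t0: "0 \<le> t0" "t0 \<le> 1" "p = \<gamma> t0"
      using p im by (auto simp: path_image_def)
    obtain t1 where t1: "0 \<le> t1" "t1 \<le> 1" "q = \<gamma> t1"
      using q im by (auto simp: path_image_def)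
    obtain t where t: "\<bar>t - t0\<bar> \<le> 1/2" "q = \<gamma> t"
    proof -
      consider "\<bar>t1 - t0\<bar> \<le> 1/2" | "\<bar>t1 + 1 - t0\<bar> \<le> 1/2" | "\<bar>t1 - 1 - t0\<bar> \<le> 1/2"
        using t0(1,2) t1(1,2) by linarith
      then show ?thesis
        using that[of t1] that[of "t1 + 1"] that[of "t1 - 1"] t1(3) per[of t1] per[of "t1 - 1"]
        by cases auto
    qed
    have td: "\<bar>t - t0\<bar> \<le> \<delta>"
    proof (rule ccontr)
      assume "\<not> ?thesis"
      then have "(t0, t) \<in> Q" using t0 t(1) by (auto simp: Q_def abs_if split: if_splits)
      then show False using \<mu>(2)[of t0 t] pq t(2) t0(3) \<mu>(1) by auto
    qed
    have all\<Gamma>: "\<gamma> x \<in> \<Gamma>" for x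
    proof -
      have k: "\<gamma> (x + real n) = \<gamma> x" for x n
      proof (induction n)
        case (Suc n)
        then show ?case using per[of "x + real n"] by (simp add: add_ac)
      qed simp
      have "\<gamma> (frac x) = \<gamma> x"
      proof (cases "\<lfloor>x\<rfloor> \<ge> 0")
        case True
        then show ?thesis using k[of "frac x" "nat \<lfloor>x\<rfloor>"] by (simp add: frac_def)
      next
        case False
        then show ?thesis using k[of x "nat (- \<lfloor>x\<rfloor>)"] by (simp add: frac_def)
      qed
      moreover have "frac x \<in> {0..1}" using frac_ge_0 frac_lt_1[of x] by (simp add: less_imp_le)
      ultimately show ?thesis using im unfolding path_image_def by (metis image_eqI)
    qed
    have orth: "inner (z - p) (\<gamma>' t0) = 0"
      unfolding t0(3) by (rule nearest_point_orthogonal_tangent[OF der]) (use near all\<Gamma> t0(3) in auto)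
    have "inner (z - p) (q - p) = inner (z - p) (\<gamma> t - \<gamma> t0 - (t - t0) *\<^sub>R \<gamma>' t0)"
      using orth t(2) t0(3) by (simp add: inner_diff_right)
    then have "\<bar>inner (z - p) (q - p)\<bar> \<le> norm (z - p) * norm (\<gamma> t - \<gamma> t0 - (t - t0) *\<^sub>R \<gamma>' t0)"
      using Cauchy_Schwarz_ineq2 by metis
    also have "\<dots> \<le> norm (z - p) * (L * \<bar>t - t0\<bar> powr (1 + \<alpha>))"
      using taylor by (intro mult_left_mono) auto
    also have "\<dots> \<le> norm (z - p) * (L * (2 / m * norm (q - p)) powr (1 + \<alpha>))"
    proof -
      have "\<bar>t - t0\<bar> \<le> 2 / m * norm (q - p)"
        using chord[of t0 t] t0 td t(2) m by (simp add: field_simps)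
      then show ?thesis using Lpos \<alpha> by (intro mult_left_mono powr_mono2) auto
    qed
    also have "\<dots> = norm (z - p) * (L * (2 / m) powr (1 + \<alpha>) * norm (q - p) powr (1 + \<alpha>))"
      using m by (subst powr_mult) auto
    finally show "\<bar>inner (z - p) (q - p)\<bar> \<le> norm (z - p) * (L * (2 / m) powr (1 + \<alpha>) * norm (q - p) powr (1 + \<alpha>))" .
  qed
qed

section \<open>A Hopf lemma in cusp regions\<close>

text \<open>
  In coordinates with origin at a boundary point and the positive real axis along the inner
  normal this is the part within distance \<open>\<rho>\<close> of a region whose edge touches the tangent line
  to order \<open>p\<close>.
\<close>

definition cusp :: "real \<Rightarrow> real \<Rightarrow> real \<Rightarrow> complex set" where
  "cusp p M \<rho> = {w. norm w \<le> \<rho> \<and> 0 < Re w \<and> M * norm w powr p \<le> Re w}"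

lemma convex_cusp:
  assumes "1 \<le> p" "0 \<le> M"
  shows "convex (cusp p M \<rho>)"
proof (rule convexI)
  fix x y :: complex and u v :: real
  assume x: "x \<in> cusp p M \<rho>" and y: "y \<in> cusp p M \<rho>" and uv: "0 \<le> u" "0 \<le> v" "u + v = 1"
  have Re: "0 < Re x" "0 < Re y" using x y by (auto simp: cusp_def)
  then have nz: "0 < norm x" "0 < norm y" by auto
  let ?w = "u *\<^sub>R x + v *\<^sub>R y"
  have n: "norm ?w \<le> u * norm x + v * norm y"
    using norm_triangle_ineq[of "u *\<^sub>R x" "v *\<^sub>R y"] uv by simp
  have "norm ?w powr p \<le> (u * norm x + v * norm y) powr p"
    using n assms(1) by (intro powr_mono2) auto
  also have "\<dots> \<le> u * norm x powr p + v * norm y powr p"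
    using convex_onD[OF powr_convex[OF assms(1)], of v "norm x" "norm y"] uv nz
    by (simp add: eq_diff_eq[symmetric, of u])
  finally have "M * norm ?w powr p \<le> M * (u * norm x powr p + v * norm y powr p)"
    using assms(2) by (rule mult_left_mono)
  also have "\<dots> = u * (M * norm x powr p) + v * (M * norm y powr p)"
    by (simp add: algebra_simps)
  also have "\<dots> \<le> u * Re x + v * Re y"
    using x y uv by (intro add_mono mult_left_mono) (auto simp: cusp_def)
  finally have 1: "M * norm ?w powr p \<le> Re ?w" by simp
  have "u * norm x + v * norm y \<le> u * \<rho> + v * \<rho>"
    using x y uv by (intro add_mono mult_left_mono) (auto simp: cusp_def)
  also have "\<dots> = \<rho>" using uv(3) by (metis distrib_right mult_1)
  finally have 2: "norm ?w \<le> \<rho>" using n by simp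
  have 3: "0 < Re ?w"
  proof (cases "u = 0")
    case True then show ?thesis using uv Re by simp
  next
    case False
    then have "0 < u * Re x" "0 \<le> v * Re y" using uv Re by auto
    then show ?thesis by simp
  qed
  show "?w \<in> cusp p M \<rho>" using 1 2 3 by (simp add: cusp_def)
qed

text \<open>
  An angle below \<open>\<pi>/2\<close> whose multiple by \<open>1 + \<alpha>\<close> is \<open>\<pi>/2 + \<alpha>\<pi>/4\<close>, where the cosine is
  negative.
\<close>

definition cusp_angle :: "real \<Rightarrow> real" where
  "cusp_angle \<alpha> = pi / 2 * (1 + \<alpha> / 2) / (1 + \<alpha>)"

text \<open>
  Nearly tangential directions make an angle with the normal that exceeds \<open>cusp_angle \<alpha>\<close>;
  multiplication by \<open>1 + \<alpha>\<close> moves it definitely past \<open>\<pi>/2\<close>.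
\<close>

lemma Re_powr_of_cos_eq:
  fixes w :: complex
  assumes "0 < \<alpha>" "\<alpha> < 1" and w: "0 < Re w"
    and small: "Re w / norm w \<le> cos (cusp_angle \<alpha>)"
  shows "Re (w powr of_real (1 + \<alpha>)) \<le> - sin (\<alpha> * pi / 4) * norm w powr (1 + \<alpha>)"
proof -
  let ?\<theta> = "Im (Ln w)" and ?\<theta>1 = "cusp_angle \<alpha>"
  have nz: "w \<noteq> 0" using w by auto
  have \<theta>: "\<bar>?\<theta>\<bar> < pi / 2" using Re_Ln_pos_lt_imp[OF w] .
  have "Re w = norm w * cos ?\<theta>"
    by (metis Re_exp exp_Ln exp_ln norm_exp_eq_Re nz zero_less_norm_iff)
  then have "cos \<bar>?\<theta>\<bar> \<le> cos ?\<theta>1" using small nz by simp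
  moreover have "0 \<le> ?\<theta>1" "?\<theta>1 \<le> pi"
    using assms(1,2) pi_gt_zero by (simp_all add: cusp_angle_def field_simps)
  ultimately have ge: "?\<theta>1 \<le> \<bar>?\<theta>\<bar>"
    using \<theta> cos_mono_le_eq[of "\<bar>?\<theta>\<bar>" ?\<theta>1] by auto
  have "(1 + \<alpha>) * ?\<theta>1 \<le> (1 + \<alpha>) * \<bar>?\<theta>\<bar>"
    using ge assms(1) by (intro mult_left_mono) auto
  moreover have e: "(1 + \<alpha>) * ?\<theta>1 = pi / 2 + \<alpha> * pi / 4"
    using assms(1) by (simp add: cusp_angle_def field_simps)
  moreover have "(1 + \<alpha>) * \<bar>?\<theta>\<bar> \<le> 2 * (pi / 2)"
    using \<theta> assms(1,2) by (intro mult_mono) auto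
  ultimately have "cos ((1 + \<alpha>) * \<bar>?\<theta>\<bar>) \<le> cos (pi / 2 + \<alpha> * pi / 4)"
    using assms(1) by (intro cos_monotone_0_pi_le) auto
  then have c: "cos ((1 + \<alpha>) * \<bar>?\<theta>\<bar>) \<le> - sin (\<alpha> * pi / 4)"
    by (simp add: cos_add)
  have "cos ((1 + \<alpha>) * ?\<theta>) = cos ((1 + \<alpha>) * \<bar>?\<theta>\<bar>)"
    by (simp add: abs_if)
  moreover have "Re (w powr of_real (1 + \<alpha>)) = norm w powr (1 + \<alpha>) * cos ((1 + \<alpha>) * ?\<theta>)"
    using nz by (simp add: powr_def Re_exp Im_exp)
  ultimately show ?thesis
    using c mult_left_mono[OF c, of "norm w powr (1 + \<alpha>)"] by (simp add: mult.commute)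
qed

text \<open>
  Up to this radius the lateral boundary of the cusp region lies in the directions beyond
  \<open>cusp_angle \<alpha>\<close>.
\<close>

definition cusp_radius :: "real \<Rightarrow> real \<Rightarrow> real" where
  "cusp_radius \<alpha> M = (cos (cusp_angle \<alpha>) / M) powr (1 / \<alpha>)"

text \<open>
  The reciprocal of an upper bound for the barrier on the circle of radius \<open>\<rho>\<close>.
\<close>

definition Hopf_const :: "real \<Rightarrow> real \<Rightarrow> real \<Rightarrow> real" where
  "Hopf_const \<alpha> M \<rho> = 1 / (\<rho> + M / sin (\<alpha> * pi / 4) * \<rho> powr (1 + \<alpha>))"

lemma cos_cusp_angle_pos:
  assumes "0 < \<alpha>"
  shows "0 < cos (cusp_angle \<alpha>)"
proof -
  have "pi / 2 * (1 + \<alpha> / 2) < pi / 2 * (1 + \<alpha>)"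
    using assms by (intro mult_strict_left_mono) auto
  then have "cusp_angle \<alpha> < pi / 2"
    unfolding cusp_angle_def using assms by (subst divide_less_eq) auto
  moreover have "0 \<le> cusp_angle \<alpha>" using assms by (simp add: cusp_angle_def)
  ultimately show ?thesis using pi_gt_zero by (intro cos_gt_zero_pi) linarith+
qed

lemma cusp_radius_pos: "0 < \<alpha> \<Longrightarrow> 0 < M \<Longrightarrow> 0 < cusp_radius \<alpha> M"
  using cos_cusp_angle_pos[of \<alpha>] by (simp add: cusp_radius_def)

lemma sin_quarter_pos:
  assumes "0 < \<alpha>" "\<alpha> < 1"
  shows "0 < sin (\<alpha> * pi / 4)"
proof -
  have "\<alpha> * pi < 1 * pi" using assms pi_gt_zero by (intro mult_strict_right_mono) auto
  then show ?thesis using assms by (intro sin_gt_zero) auto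
qed

lemma Hopf_const_pos:
  assumes "0 < \<alpha>" "\<alpha> < 1" "0 < M" "0 < \<rho>"
  shows "0 < Hopf_const \<alpha> M \<rho>"
  unfolding Hopf_const_def using assms sin_quarter_pos[of \<alpha>]
  by (intro divide_pos_pos add_pos_nonneg) auto

text \<open>
  The barrier is \<open>Re (B w)\<close> for \<open>B w = w + A w\<^sup>1\<^sup>+\<^sup>\<alpha>\<close>. It is at least \<open>s\<close> at \<open>s\<close> on the axis,
  and with \<open>A = M / sin (\<alpha>\<pi>/4)\<close> it is nonpositive on the lateral boundary, where the second
  term outweighs \<open>Re w = M |w|\<^sup>1\<^sup>+\<^sup>\<alpha>\<close>. Comparing \<open>k m Re B\<close> with \<open>Re \<Phi>\<close> through the maximum
  modulus of \<open>exp (k m B - \<Phi>)\<close> gives the bound. The tip of the cusp may lie outside \<open>S\<close>, so a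
  disc of radius \<open>\<tau>\<close> about it is removed first; the resulting error vanishes with \<open>\<tau>\<close>.
\<close>

lemma cusp_Hopf:
  assumes \<alpha>: "0 < \<alpha>" "\<alpha> < 1" and M: "0 < M" and \<rho>: "0 < \<rho>" "\<rho> \<le> cusp_radius \<alpha> M"
    and S: "open S" and hol: "\<Phi> holomorphic_on S" and sub: "cusp (1 + \<alpha>) M \<rho> \<subseteq> S"
    and pos: "\<And>w. w \<in> cusp (1 + \<alpha>) M \<rho> \<Longrightarrow> 0 \<le> Re (\<Phi> w)"
    and outer: "\<And>w. w \<in> cusp (1 + \<alpha>) M \<rho> \<Longrightarrow> norm w = \<rho> \<Longrightarrow> m \<le> Re (\<Phi> w)"
    and m: "0 \<le> m" and s: "0 < s" "s < \<rho>"
  shows "Hopf_const \<alpha> M \<rho> * m * s \<le> Re (\<Phi> (of_real s))"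
proof -
  let ?p = "1 + \<alpha>"
  define \<epsilon> where "\<epsilon> = cos (cusp_angle \<alpha>)"
  define \<kappa> where "\<kappa> = sin (\<alpha> * pi / 4)"
  have \<epsilon>: "0 < \<epsilon>" unfolding \<epsilon>_def by (rule cos_cusp_angle_pos[OF \<alpha>(1)])
  have \<epsilon>1: "\<epsilon> \<le> 1" unfolding \<epsilon>_def by (rule cos_le_one)
  have \<kappa>: "0 < \<kappa>" unfolding \<kappa>_def by (rule sin_quarter_pos[OF \<alpha>])
  define A where "A = M / \<kappa>"
  have A: "0 < A" using M \<kappa> by (simp add: A_def)
  define k where "k = Hopf_const \<alpha> M \<rho>"
  have k: "0 < k" unfolding k_def by (rule Hopf_const_pos[OF \<alpha> M \<rho>(1)])
  have k_eq: "k = 1 / (\<rho> + A * \<rho> powr ?p)" by (simp add: k_def Hopf_const_def A_def \<kappa>_def)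
  have den: "0 < \<rho> + A * \<rho> powr ?p" using \<rho> A by (intro add_pos_nonneg) auto
  have small: "M * r powr \<alpha> \<le> \<epsilon>" if "0 < r" "r \<le> \<rho>" for r
  proof -
    have "r powr \<alpha> \<le> cusp_radius \<alpha> M powr \<alpha>" using that \<rho> \<alpha> by (intro powr_mono2) auto
    also have "\<dots> = \<epsilon> / M" using \<epsilon> M \<alpha> by (simp add: cusp_radius_def \<epsilon>_def powr_powr)
    finally show ?thesis using M by (simp add: field_simps)
  qed
  have split: "r powr ?p = r * r powr \<alpha>" if "0 < r" for r :: real
    using that by (simp add: powr_add)
  define B where "B w = w + of_real A * w powr of_real ?p" for w :: complex
  have B_norm: "Re (B w) \<le> norm w + A * norm w powr ?p" for w
  proof -
    have "Re (B w) \<le> norm w + norm (of_real A * w powr of_real ?p)"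
      unfolding B_def by (metis complex_Re_le_cmod norm_triangle_ineq order_trans)
    also have "norm (of_real A * w powr of_real ?p) = A * norm w powr ?p"
      using A norm_powr_real_powr'[of "of_real ?p" w] by (simp add: norm_mult)
    finally show ?thesis .
  qed
  have B_lateral: "Re (B w) \<le> 0" if "0 < Re w" "norm w \<le> \<rho>" "Re w = M * norm w powr ?p" for w
  proof -
    have nz: "0 < norm w" using that(1) by auto
    have "Re w / norm w = M * norm w powr \<alpha>"
      using that(3) nz split[OF nz] by (simp add: field_simps)
    also have "\<dots> \<le> \<epsilon>" using small[OF nz] that(2) by simp
    finally have "Re (w powr of_real ?p) \<le> - \<kappa> * norm w powr ?p"
      unfolding \<epsilon>_def \<kappa>_def by (rule Re_powr_of_cos_eq[OF \<alpha> that(1)])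
    then have "A * Re (w powr of_real ?p) \<le> A * (- \<kappa> * norm w powr ?p)"
      using A by (intro mult_left_mono) auto
    also have "\<dots> = - Re w" using \<kappa> that(3) by (simp add: A_def)
    finally show ?thesis by (simp add: B_def)
  qed
  define E where "E w = exp (of_real (k * m) * B w - \<Phi> w)" for w
  have bound: "k * m * s - Re (\<Phi> (of_real s)) \<le> k * m * (\<tau> + A * \<tau> powr ?p)"
    if \<tau>: "0 < \<tau>" "\<tau> < s" for \<tau>
  proof -
    \<comment> \<open>The cusp region without the disc of radius \<open>\<tau>\<close> about its tip.\<close>
    define T where "T = {w::complex. \<tau> \<le> norm w} \<inter> {w. norm w \<le> \<rho>} \<inter> {w. M * norm w powr ?p \<le> Re w}"
    have cn: "continuous_on UNIV (\<lambda>w::complex. M * norm w powr ?p)"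
      using \<alpha> by (intro continuous_intros continuous_on_powr') auto
    have "closed T" unfolding T_def
      by (intro closed_Int closed_Collect_le continuous_intros cn)
    have Tpos: "0 < Re w" if "w \<in> T" for w
    proof -
      have "0 < norm w" using that \<tau> by (auto simp: T_def)
      then have "0 < M * norm w powr ?p" using M by (intro mult_pos_pos) auto
      then show ?thesis using that by (auto simp: T_def)
    qed
    have T_cusp: "T \<subseteq> cusp ?p M \<rho>" using Tpos by (auto simp: T_def cusp_def)
    have "bounded T" by (rule bounded_subset[OF bounded_cball[of 0 \<rho>]]) (auto simp: T_def)
    have holB: "B holomorphic_on {w. 0 < Re w}"
      unfolding B_def by (intro holomorphic_intros) (auto simp: complex_nonpos_Reals_iff)
    have holE: "E holomorphic_on S \<inter> {w. 0 < Re w}"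
      unfolding E_def
      by (intro holomorphic_intros holomorphic_on_subset[OF holB] holomorphic_on_subset[OF hol]) auto
    have T_sub: "T \<subseteq> S \<inter> {w. 0 < Re w}" using T_cusp sub Tpos by blast
    have "norm (E (of_real s)) \<le> exp (k * m * (\<tau> + A * \<tau> powr ?p))"
    proof (rule maximum_modulus_frontier[of E T])
      show "E holomorphic_on interior T"
        using holE by (rule holomorphic_on_subset) (use T_sub interior_subset in blast)
      show "continuous_on (closure T) E"
        using \<open>closed T\<close> holE T_sub
        by (metis closure_closed continuous_on_subset holomorphic_on_imp_continuous_on)
      show "bounded T" by fact
      have "M * s powr ?p \<le> s"
      proof -
        have "M * s powr \<alpha> \<le> 1" using small[OF s(1)] s(2) \<epsilon>1 by simp
        then have "s * (M * s powr \<alpha>) \<le> s * 1" using s(1) by (intro mult_left_mono) auto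
        then show ?thesis using split[OF s(1)] by (simp add: mult_ac)
      qed
      then show "of_real s \<in> T" using s \<tau> by (simp add: T_def)
      fix w assume w: "w \<in> frontier T"
      have wT: "w \<in> T" using w \<open>closed T\<close> by (metis frontier_subset_closed subsetD)
      have Phi: "0 \<le> Re (\<Phi> w)" using pos T_cusp wT by blast
      have nE: "norm (E w) = exp (k * m * Re (B w) - Re (\<Phi> w))"
        by (simp add: E_def)
      consider "norm w = \<tau>" | "norm w = \<rho>" | "Re w = M * norm w powr ?p"
      proof (rule ccontr)
        assume no: "\<not> thesis"
        let ?I = "{w::complex. \<tau> < norm w} \<inter> {w. norm w < \<rho>} \<inter> {w. M * norm w powr ?p < Re w}"
        have "open ?I" by (intro open_Int open_Collect_less continuous_intros cn)
        moreover have "?I \<subseteq> T" by (auto simp: T_def)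
        moreover have "w \<in> ?I" using wT no that by (auto simp: T_def less_le)
        ultimately have "w \<in> interior T" by (auto simp: interior_def)
        then show False using w by (simp add: frontier_def)
      qed
      then have "k * m * Re (B w) - Re (\<Phi> w) \<le> k * m * (\<tau> + A * \<tau> powr ?p)"
      proof cases
        case 1
        have "k * m * Re (B w) \<le> k * m * (\<tau> + A * \<tau> powr ?p)"
          using B_norm[of w] 1 k m by (intro mult_left_mono) auto
        then show ?thesis using Phi by simp
      next
        case 2
        have "k * m * Re (B w) \<le> k * m * (\<rho> + A * \<rho> powr ?p)"
          using B_norm[of w] 2 k m by (intro mult_left_mono) auto
        also have "\<dots> = m" using den by (simp add: k_eq)
        also have "\<dots> \<le> Re (\<Phi> w)" using outer T_cusp wT 2 by blast
        finally have "k * m * Re (B w) - Re (\<Phi> w) \<le> 0" by simp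
        also have "0 \<le> k * m * (\<tau> + A * \<tau> powr ?p)" using k m A \<tau> by simp
        finally show ?thesis .
      next
        case 3
        have "Re (B w) \<le> 0" using B_lateral[OF Tpos[OF wT] _ 3] wT by (simp add: T_def)
        then have "k * m * Re (B w) \<le> 0" using k m by (simp add: mult_nonneg_nonpos)
        moreover have "0 \<le> k * m * (\<tau> + A * \<tau> powr ?p)" using k m A \<tau> by simp
        ultimately show ?thesis using Phi by linarith
      qed
      then show "norm (E w) \<le> exp (k * m * (\<tau> + A * \<tau> powr ?p))"
        unfolding nE by simp
    qed
    moreover have "norm (E (of_real s)) = exp (k * m * Re (B (of_real s)) - Re (\<Phi> (of_real s)))"
      by (simp add: E_def)
    ultimately have "k * m * Re (B (of_real s)) - Re (\<Phi> (of_real s)) \<le> k * m * (\<tau> + A * \<tau> powr ?p)"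
      by simp
    moreover have "s \<le> Re (B (of_real s))"
    proof -
      have "complex_of_real s powr of_real ?p = of_real (s powr ?p)"
        using s(1) by (intro powr_of_real) auto
      then have "Re (B (of_real s)) = s + A * s powr ?p" by (simp add: B_def)
      then show ?thesis using A by simp
    qed
    then have "k * m * s \<le> k * m * Re (B (of_real s))"
      using k m by (intro mult_left_mono) auto
    ultimately show ?thesis by linarith
  qed
  have "((\<lambda>\<tau>. k * m * (\<tau> + A * \<tau> powr ?p)) \<longlongrightarrow> k * m * (0 + A * 0 powr ?p)) (at_right 0)"
    using \<alpha> by (intro tendsto_intros tendsto_powr') (auto intro: eventually_mono[OF eventually_at_right_less])
  then have lim: "((\<lambda>\<tau>. k * m * (\<tau> + A * \<tau> powr ?p)) \<longlongrightarrow> 0) (at_right 0)"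
    using \<alpha> by simp
  have "k * m * s - Re (\<Phi> (of_real s)) \<le> 0"
  proof (rule tendsto_lowerbound[OF lim])
    show "\<forall>\<^sub>F \<tau> in at_right 0. k * m * s - Re (\<Phi> (of_real s)) \<le> k * m * (\<tau> + A * \<tau> powr ?p)"
      using bound s(1) by (auto simp: eventually_at_right_field)
  qed simp
  then show ?thesis by (simp add: k_def)
qed

section \<open>A lower bound for the boundary distance of the image\<close>

text \<open>
  The functional \<open>x \<mapsto> u \<bullet> (b - x)\<close> is the distance to a supporting hyperplane at the boundary
  point \<open>b\<close> nearest to \<open>w\<close>; moving from \<open>x\<close> towards the hyperplane cannot leave \<open>S\<close> before the
  boundary distance of \<open>x\<close> is used up.
\<close>

lemma convex_supporting_functional:
  fixes S :: "'a::euclidean_space set"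
  assumes "convex S" "open S" and w: "w \<in> S" and fr: "frontier S \<noteq> {}"
  obtains u b where "norm u = 1" "\<And>x. x \<in> S \<Longrightarrow> infdist x (frontier S) \<le> inner u (b - x)"
    "inner u (b - w) \<le> infdist w (frontier S)"
proof -
  obtain b where b: "b \<in> frontier S" "infdist w (frontier S) = dist w b"
    using infdist_attains_inf[OF frontier_closed fr] by metis
  have "b \<notin> S" using b(1) \<open>open S\<close> by (simp add: frontier_def interior_open)
  then obtain a c where a: "a \<noteq> 0" "\<And>x. x \<in> S \<Longrightarrow> inner a x \<le> c" "c \<le> inner a b"
    using separating_hyperplane_sets[OF \<open>convex S\<close> convex_singleton[of b]] w by auto
  define u where "u = a /\<^sub>R norm a"
  have u: "norm u = 1" using a(1) by (simp add: u_def)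
  have nonneg: "0 \<le> inner u (b - x)" if "x \<in> S" for x
  proof -
    have "0 \<le> inner a (b - x)" using a(2)[OF that] a(3) by (simp add: inner_diff_right)
    then show ?thesis by (simp add: u_def)
  qed
  show ?thesis
  proof (rule that[OF u])
    fix x assume x: "x \<in> S"
    show "infdist x (frontier S) \<le> inner u (b - x)"
    proof (rule dense_le)
      fix t assume t: "t < infdist x (frontier S)"
      show "t \<le> inner u (b - x)"
      proof (cases "t \<le> 0")
        case True then show ?thesis using nonneg[OF x] by simp
      next
        case False
        then have "x + t *\<^sub>R u \<in> ball x (infdist x (frontier S))"
          using t u by (simp add: dist_norm)
        then have "x + t *\<^sub>R u \<in> S" using ball_infdist_frontier_subset[OF x] by blast
        from nonneg[OF this] have "0 \<le> inner u (b - x) - t * inner u u"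
          by (simp add: inner_diff_right inner_add_right)
        moreover have "inner u u = 1" using u by (simp add: dot_square_norm)
        ultimately show ?thesis by simp
      qed
    qed
  next
    show "inner u (b - w) \<le> infdist w (frontier S)"
      using norm_cauchy_schwarz[of u "b - w"] u b(2) by (simp add: dist_norm norm_minus_commute)
  qed
qed

text \<open>
  The region is convex, contains \<open>z\<close>, and by the strict inequality \<open>M < M'\<close> avoids the
  boundary of \<open>D\<close>. Being connected it then lies in \<open>D\<close>; as \<open>z\<close> itself fixes the direction of
  the normal, this works without orienting the boundary.
\<close>

lemma normal_cusp_subset:
  assumes D: "z \<in> D" and p: "p \<in> frontier D" and s: "s = norm (z - p)" "0 < s"
    and near: "\<And>x. x \<in> frontier D \<Longrightarrow> dist z p \<le> dist z x"
    and dev: "\<And>q. q \<in> frontier D \<Longrightarrow> norm (q - p) \<le> \<rho> \<Longrightarrow>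
       \<bar>inner (z - p) (q - p)\<bar> \<le> norm (z - p) * (M * norm (q - p) powr r)"
    and M: "0 \<le> M" "M < M'" and r: "1 \<le> r" and sm: "s \<le> \<rho>" "M' * s powr r \<le> s"
    and w: "w \<in> cusp r M' \<rho>"
  shows "p + (z - p) / of_real s * w \<in> D"
proof -
  define n where "n = (z - p) / of_real s"
  have n: "norm n = 1" using s by (simp add: n_def norm_divide)
  have zp: "z - p = s *\<^sub>R n" using s(2) by (simp add: n_def scaleR_conv_of_real)
  let ?T = "(\<lambda>w. p + n * w) ` cusp r M' \<rho>"
  have "connected ?T"
    using convex_cusp[OF r, of M' \<rho>] M
    by (intro connected_continuous_image continuous_intros convex_connected) auto
  moreover have "?T \<inter> frontier D = {}"
  proof (rule ccontr)
    assume "?T \<inter> frontier D \<noteq> {}"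
    then obtain v where v: "v \<in> cusp r M' \<rho>" "p + n * v \<in> frontier D" by auto
    have nv: "norm (n * v) = norm v" using n by (simp add: norm_mult)
    have vpos: "0 < norm v" "norm v \<le> \<rho>" "M' * norm v powr r \<le> Re v" "0 < Re v"
      using v(1) by (auto simp: cusp_def)
    have "inner n (n * v) = Re v"
    proof -
      have "inner n (n * v) = (norm n)\<^sup>2 * Re v"
        unfolding cmod_power2 by (simp add: inner_complex_def power2_eq_square algebra_simps)
      then show ?thesis using n by simp
    qed
    then have "inner (z - p) (n * v) = s * Re v" by (simp add: zp)
    then have "s * Re v \<le> s * (M * norm v powr r)"
      using dev[OF v(2)] nv vpos s by simp
    then have "Re v \<le> M * norm v powr r" using s(2) by simp
    also have "\<dots> < M' * norm v powr r" using M vpos(1) by simp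
    finally show False using vpos(3) by simp
  qed
  moreover have "z \<in> ?T"
  proof (rule image_eqI)
    show "z = p + n * of_real s" using s(2) by (simp add: n_def)
    show "of_real s \<in> cusp r M' \<rho>" using s sm by (simp add: cusp_def)
  qed
  ultimately have "?T \<subseteq> D" using connected_Int_frontier[of ?T D] D by blast
  then show ?thesis using w by (auto simp: n_def)
qed

text \<open>
  Near the boundary the Hopf lemma is applied to the distance of \<open>f\<close> to a supporting line of
  \<open>D'\<close>, in the normal direction at the nearest boundary point. The outer arcs of the cusp
  regions with the doubled constant \<open>2 * M1\<close> stay at distance \<open>\<eta>\<close> from the boundary, since a
  slightly fatter region still fits into \<open>D\<close>; so they all lie in one compact set \<open>K\<close>, which
  makes the bound \<open>m\<close> uniform. Away from the boundary compactness suffices.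
\<close>

lemma image_boundary_distance_lower_bound:
  assumes \<alpha>: "0 < \<alpha>" "\<alpha> < 1" and dom: "C1_Hoelder_domain \<alpha> D"
    and h: "h holomorphic_on D" and g: "g holomorphic_on D"
    and f: "\<And>w. w \<in> D \<Longrightarrow> f w = h w + cnj (g w)"
    and D': "f ` D = D'" "open D'" "convex D'" "frontier D' \<noteq> {}"
  shows "\<exists>c>0. \<forall>z\<in>D. c * infdist z (frontier D) \<le> infdist (f z) (frontier D')"
proof -
  let ?r = "1 + \<alpha>"
  obtain \<Gamma> where \<Gamma>: "C1_Hoelder_Jordan_curve \<alpha> \<Gamma>" "D = inside \<Gamma>"
    using dom unfolding C1_Hoelder_domain_def by blast
  obtain \<gamma> :: "real \<Rightarrow> complex" where \<gamma>: "simple_path \<gamma>" "path_image \<gamma> = \<Gamma>" "\<gamma> 1 = \<gamma> 0"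
    using \<Gamma>(1) unfolding C1_Hoelder_Jordan_curve_def by (metis add_0)
  have "pathfinish \<gamma> = pathstart \<gamma>" using \<gamma>(3) by (simp add: pathfinish_def pathstart_def)
  from Jordan_inside_outside[OF \<gamma>(1) this]
  have D: "D \<noteq> {}" "open D" "bounded D" "frontier D = \<Gamma>" using \<gamma>(2) \<Gamma>(2) by auto
  have fr: "frontier D \<noteq> {}" using D(1,3) frontier_not_empty[of D] not_bounded_UNIV by metis
  obtain M \<rho>1 where M: "0 \<le> M" "0 < \<rho>1"
    and dev: "\<And>z p q. p \<in> \<Gamma> \<Longrightarrow> (\<And>x. x \<in> \<Gamma> \<Longrightarrow> dist z p \<le> dist z x) \<Longrightarrow> q \<in> \<Gamma> \<Longrightarrow> norm (q - p) \<le> \<rho>1 \<Longrightarrow>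
       \<bar>inner (z - p) (q - p)\<bar> \<le> norm (z - p) * (M * norm (q - p) powr ?r)"
    using C1_Hoelder_curve_normal_deviation[OF \<Gamma>(1) \<alpha>(1)] by metis
  define M1 where "M1 = M + 1"
  have M1: "0 < M1" "M < M1" using M by (auto simp: M1_def)
  have M2: "0 < 2 * M1" using M1 by simp
  \<comment> \<open>The bounds serve, in this order, to use the curve estimate up to \<open>2 * \<rho>\<close>, to apply
    the Hopf lemma, and to have the points \<open>s \<le> \<rho>\<close> of the axis in the cusp region.\<close>
  define \<rho> where "\<rho> = min (\<rho>1 / 2) (min (cusp_radius \<alpha> (2 * M1)) ((1 / M1) powr (1 / \<alpha>)))"
  have \<rho>: "0 < \<rho>" "2 * \<rho> \<le> \<rho>1" "\<rho> \<le> cusp_radius \<alpha> (2 * M1)" "\<rho> \<le> (1 / M1) powr (1 / \<alpha>)"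
    using M(2) cusp_radius_pos[OF \<alpha>(1) M2] M1 by (auto simp: \<rho>_def)
  have small: "M1 * s powr ?r \<le> s" if "0 < s" "s \<le> \<rho>" for s
  proof -
    have "s powr \<alpha> \<le> ((1 / M1) powr (1 / \<alpha>)) powr \<alpha>"
      using that \<rho>(4) \<alpha> by (intro powr_mono2) auto
    also have "\<dots> = 1 / M1" using \<alpha> M1 by (simp add: powr_powr)
    finally have "M1 * s powr \<alpha> \<le> 1" using M1 by (simp add: field_simps)
    then have "s * (M1 * s powr \<alpha>) \<le> s * 1" using that by (intro mult_left_mono) auto
    then show ?thesis using that by (simp add: powr_add mult_ac)
  qed
  have "((\<lambda>\<eta>. M1 * (\<rho> + \<eta>) powr ?r + \<eta>) \<longlongrightarrow> M1 * (\<rho> + 0) powr ?r + 0) (at_right 0)"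
    using \<rho>(1) by (intro tendsto_intros) auto
  moreover have "M1 * (\<rho> + 0) powr ?r + 0 < 2 * M1 * \<rho> powr ?r"
    using \<rho>(1) M1(1) by simp
  ultimately have "\<forall>\<^sub>F \<eta> in at_right 0. M1 * (\<rho> + \<eta>) powr ?r + \<eta> < 2 * M1 * \<rho> powr ?r"
    by (rule order_tendstoD(2))
  then obtain \<eta>0 where \<eta>0: "0 < \<eta>0" "\<And>\<eta>. 0 < \<eta> \<Longrightarrow> \<eta> < \<eta>0 \<Longrightarrow> M1 * (\<rho> + \<eta>) powr ?r + \<eta> < 2 * M1 * \<rho> powr ?r"
    unfolding eventually_at_right_field by auto
  define \<eta> where "\<eta> = min (\<eta>0 / 2) \<rho>"
  have \<eta>: "0 < \<eta>" "\<eta> \<le> \<rho>" "M1 * (\<rho> + \<eta>) powr ?r + \<eta> < 2 * M1 * \<rho> powr ?r"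
    using \<eta>0 \<rho>(1) by (auto simp: \<eta>_def)
  \<comment> \<open>Away from the boundary the intersection with \<open>closure D\<close> is the same as that with
    \<open>D\<close>, but visibly closed.\<close>
  define K where "K = closure D \<inter> {q. \<eta> \<le> infdist q (frontier D)}"
  have "compact K"
    unfolding K_def using D(3)
    by (intro compact_Int_closed closed_Collect_le continuous_intros) (auto simp: compact_closure)
  have KD: "K \<subseteq> D"
  proof
    fix q assume q: "q \<in> K"
    then have "q \<notin> frontier D" using \<eta>(1) by (auto simp: K_def)
    then show "q \<in> D" using q closure_Un_frontier[of D] by (auto simp: K_def)
  qed
  have contf: "continuous_on D f"
  proof (rule continuous_on_eq)
    show "continuous_on D (\<lambda>w. h w + cnj (g w))"
      by (intro continuous_intros holomorphic_on_imp_continuous_on h g)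
  qed (simp add: f)
  have dpos: "0 < infdist (f z) (frontier D')" if "z \<in> D" for z
  proof (rule infdist_pos_not_in_closed[OF frontier_closed D'(4)])
    show "f z \<notin> frontier D'" using that D'(1,2) by (auto simp: frontier_def interior_open)
  qed
  obtain m where m: "0 < m" "\<And>q. q \<in> K \<Longrightarrow> m \<le> infdist (f q) (frontier D')"
  proof (cases "K = {}")
    case True then show ?thesis using that[of 1] by auto
  next
    case False
    have "continuous_on K (\<lambda>q. infdist (f q) (frontier D'))"
      by (intro continuous_intros continuous_on_subset[OF contf KD])
    then obtain q where "q \<in> K" "\<And>x. x \<in> K \<Longrightarrow> infdist (f q) (frontier D') \<le> infdist (f x) (frontier D')"
      using continuous_attains_inf[OF \<open>compact K\<close> False] by blast
    then show ?thesis using that[of "infdist (f q) (frontier D')"] dpos KD by auto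
  qed
  define k where "k = Hopf_const \<alpha> (2 * M1) \<rho>"
  have k: "0 < k" unfolding k_def by (rule Hopf_const_pos[OF \<alpha> M2 \<rho>(1)])
  have near_case: "k * m * infdist z (frontier D) \<le> infdist (f z) (frontier D')"
    if z: "z \<in> D" and zs: "infdist z (frontier D) < \<rho>" for z
  proof -
    obtain p where p: "p \<in> frontier D" "infdist z (frontier D) = dist z p"
      using infdist_attains_inf[OF frontier_closed fr] by metis
    define s where "s = norm (z - p)"
    define n where "n = (z - p) / of_real s"
    have pD: "p \<notin> D" using p(1) D(2) by (simp add: frontier_def interior_open)
    have s: "0 < s" "s < \<rho>" using z pD zs p(2) by (auto simp: s_def dist_norm)
    have n: "norm n = 1" using s by (simp add: n_def norm_divide s_def)
    have nearest: "dist z p \<le> dist z x" if "x \<in> frontier D" for x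
      using infdist_le[OF that, of z] p(2) by simp
    have inD: "p + n * w \<in> D" if "w \<in> cusp ?r M1 (2 * \<rho>)" for w
      unfolding n_def
    proof (rule normal_cusp_subset[OF z p(1) s_def s(1) nearest _ M(1) M1(2) _ _ _ that])
      show "\<bar>inner (z - p) (q - p)\<bar> \<le> norm (z - p) * (M * norm (q - p) powr ?r)"
        if "q \<in> frontier D" "norm (q - p) \<le> 2 * \<rho>" for q
        using dev[of p z q] p(1) nearest that \<rho>(2) D(4) by auto
    qed (use \<alpha> s small in auto)
    have sub: "cusp ?r (2 * M1) \<rho> \<subseteq> cusp ?r M1 (2 * \<rho>)"
    proof
      fix w assume w: "w \<in> cusp ?r (2 * M1) \<rho>"
      have "M1 * norm w powr ?r \<le> 2 * M1 * norm w powr ?r"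
        using M1(1) by (intro mult_right_mono) auto
      then show "w \<in> cusp ?r M1 (2 * \<rho>)" using w \<rho>(1) by (auto simp: cusp_def)
    qed
    have inK: "p + n * w \<in> K" if w: "w \<in> cusp ?r (2 * M1) \<rho>" and wn: "norm w = \<rho>" for w
    proof -
      have qD: "p + n * w \<in> D" using inD w sub by blast
      have "\<eta> \<le> dist (p + n * w) x" if x: "x \<in> frontier D" for x
      proof (rule ccontr)
        assume "\<not> ?thesis"
        then have dx: "norm (x - (p + n * w)) < \<eta>" by (simp add: dist_norm norm_minus_commute)
        define v where "v = (x - p) / n"
        have xv: "x = p + n * v" using n by (auto simp: v_def)
        have "x - (p + n * w) = n * (v - w)" by (simp add: xv algebra_simps)
        then have vw: "norm (v - w) < \<eta>" using dx n by (simp add: norm_mult)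
        have nv: "norm v \<le> \<rho> + \<eta>" using norm_triangle_sub[of v w] vw wn by simp
        have "Re w - Re v \<le> norm (v - w)"
          using abs_Re_le_cmod[of "v - w"] by simp
        then have "Re v > Re w - \<eta>" using vw by simp
        moreover have "2 * M1 * \<rho> powr ?r \<le> Re w" using w wn by (simp add: cusp_def)
        moreover have "M1 * norm v powr ?r \<le> M1 * (\<rho> + \<eta>) powr ?r"
          using nv M1(1) \<alpha> by (intro mult_left_mono powr_mono2) auto
        ultimately have Rv: "M1 * norm v powr ?r < Re v" using \<eta>(3) by linarith
        moreover have "0 \<le> M1 * norm v powr ?r" using M1(1) by simp
        ultimately have "0 < Re v" by linarith
        then have "v \<in> cusp ?r M1 (2 * \<rho>)" using Rv nv \<eta>(2) by (simp add: cusp_def)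
        then have "x \<in> D" using inD xv by blast
        then show False using x D(2) by (simp add: frontier_def interior_open)
      qed
      then have "\<eta> \<le> infdist (p + n * w) (frontier D)"
        using infdist_attains_inf[OF frontier_closed fr, of "p + n * w"] by metis
      then show ?thesis using qD closure_subset by (auto simp: K_def)
    qed
    have fz: "f z \<in> D'" using z D'(1) by blast
    obtain u b where u: "norm u = 1" "\<And>x. x \<in> D' \<Longrightarrow> infdist x (frontier D') \<le> inner u (b - x)"
      "inner u (b - f z) \<le> infdist (f z) (frontier D')"
      using convex_supporting_functional[OF D'(3,2) fz D'(4)] by metis
    \<comment> \<open>The distance to the supporting line is harmonic; this is a holomorphic function
      with that real part.\<close>
    define \<Phi> where "\<Phi> q = cnj u * (b - h q) - u * g q" for q
    have Re\<Phi>: "Re (\<Phi> q) = inner u (b - f q)" if "q \<in> D" for q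
      using f[OF that] by (simp add: \<Phi>_def inner_complex_def algebra_simps)
    have \<Phi>low: "infdist (f q) (frontier D') \<le> Re (\<Phi> q)" if "q \<in> D" for q
      using u(2)[of "f q"] Re\<Phi>[OF that] that D'(1) by auto
    have "k * m * s \<le> Re ((\<Phi> \<circ> (\<lambda>w. p + n * w)) (of_real s))"
      unfolding k_def
    proof (rule cusp_Hopf[OF \<alpha> M2 \<rho>(1,3)])
      show "open ((\<lambda>w. p + n * w) -` D)"
        by (intro open_vimage D(2) continuous_intros)
      have "\<Phi> holomorphic_on D" unfolding \<Phi>_def by (intro holomorphic_intros h g)
      then show "\<Phi> \<circ> (\<lambda>w. p + n * w) holomorphic_on (\<lambda>w. p + n * w) -` D"
        by (rule holomorphic_on_compose_gen[rotated]) (auto intro!: holomorphic_intros)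
      show "cusp ?r (2 * M1) \<rho> \<subseteq> (\<lambda>w. p + n * w) -` D" using inD sub by auto
      show "0 \<le> Re ((\<Phi> \<circ> (\<lambda>w. p + n * w)) w)" if "w \<in> cusp ?r (2 * M1) \<rho>" for w
        using \<Phi>low[of "p + n * w"] infdist_nonneg[of "f (p + n * w)" "frontier D'"] inD sub that
        by (auto intro: order_trans)
      show "m \<le> Re ((\<Phi> \<circ> (\<lambda>w. p + n * w)) w)" if "w \<in> cusp ?r (2 * M1) \<rho>" "norm w = \<rho>" for w
        using \<Phi>low[of "p + n * w"] m(2)[OF inK[OF that]] KD inK[OF that] by (auto intro: order_trans)
    qed (use m s in auto)
    also have "p + n * of_real s = z" using s by (simp add: n_def)
    then have "Re ((\<Phi> \<circ> (\<lambda>w. p + n * w)) (of_real s)) = inner u (b - f z)"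
      using Re\<Phi>[OF z] by simp
    also have "\<dots> \<le> infdist (f z) (frontier D')" by (rule u(3))
    finally show ?thesis using p(2) by (simp add: s_def dist_norm)
  qed
  obtain w0 where w0: "w0 \<in> frontier D" using fr by blast
  obtain R where R: "0 < R" "\<And>z. z \<in> D \<Longrightarrow> infdist z (frontier D) \<le> R"
  proof -
    obtain e where e: "\<And>z. z \<in> D \<Longrightarrow> dist w0 z \<le> e"
      using D(3) bounded_any_center[of D w0] by auto
    have "infdist z (frontier D) \<le> max e 1" if "z \<in> D" for z
      using infdist_le[OF w0, of z] e[OF that] by (simp add: dist_commute)
    then show ?thesis using that[of "max e 1"] by simp
  qed
  show ?thesis
  proof (intro exI[of _ "min (k * m) (m / R)"] conjI ballI)
    show "0 < min (k * m) (m / R)" using k m(1) R(1) by simp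
    fix z assume z: "z \<in> D"
    let ?d = "infdist z (frontier D)"
    show "min (k * m) (m / R) * ?d \<le> infdist (f z) (frontier D')"
    proof (cases "?d < \<rho>")
      case True
      have "min (k * m) (m / R) * ?d \<le> k * m * ?d"
        by (intro mult_right_mono infdist_nonneg) auto
      then show ?thesis using near_case[OF z True] by linarith
    next
      case False
      then have "z \<in> K" using z closure_subset \<eta>(2) by (auto simp: K_def)
      have "min (k * m) (m / R) * ?d \<le> m / R * ?d"
        by (intro mult_right_mono infdist_nonneg) auto
      also have "\<dots> \<le> m / R * R" using R m by (intro mult_left_mono) (auto simp: z)
      also have "\<dots> = m" using R(1) by simp
      finally show ?thesis using m(2)[OF \<open>z \<in> K\<close>] by linarith
    qed
  qed
qed

theorem theorem1p3:
  fixes D D' :: "complex set" and f :: "complex \<Rightarrow> complex"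
  assumes "hyperbolic_domain D" and "frontier D \<noteq> {}"
    and "hyperbolic_domain D'" and "frontier D' \<noteq> {}"
    and "harmonic_mapping_on f D" and "inj_on f D" and "f ` D = D'"
  shows "(\<exists>c>0. \<forall>z\<in>D. infdist z (frontier D) * Lambda f z \<ge> c * infdist (f z) (frontier D')) \<and>
    ((\<exists>\<alpha>. 0 < \<alpha> \<and> \<alpha> < 1 \<and> C1_Hoelder_domain \<alpha> D) \<and> bounded D' \<and> convex D' \<longrightarrow>
       (\<exists>c>0. \<forall>z\<in>D. Lambda f z \<ge> c))"
proof -
  have D: "open D" "connected D" "simply_connected D" and D': "open D'"
    using assms(1,3) by (auto simp: hyperbolic_domain_def)
  obtain h g where h: "h holomorphic_on D" and g: "g holomorphic_on D"
    and f: "\<And>w. w \<in> D \<Longrightarrow> f w = h w + cnj (g w)"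
    using harmonic_mapping_canonical_decomposition[OF assms(5) D] by metis
  define c1 where "c1 = 1 / (4 * omit_const)"
  have c1: "0 < c1" by (simp add: c1_def omit_const_def)
  have first: "c1 * infdist (f z) (frontier D') \<le> infdist z (frontier D) * Lambda f z" if "z \<in> D" for z
    using harmonic_univalent_distance_bound[OF h g D(1,2) that assms(2) f assms(6)] assms(7)
    by (simp add: c1_def)
  have second: "\<exists>c>0. \<forall>z\<in>D. Lambda f z \<ge> c"
    if dom: "0 < \<alpha>" "\<alpha> < 1" "C1_Hoelder_domain \<alpha> D" "convex D'" for \<alpha>
  proof -
    obtain c2 where c2: "0 < c2" "\<And>z. z \<in> D \<Longrightarrow> c2 * infdist z (frontier D) \<le> infdist (f z) (frontier D')"
      using image_boundary_distance_lower_bound[OF dom(1-3) h g f assms(7) D' dom(4) assms(4)] by blast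
    have "c1 * c2 \<le> Lambda f z" if z: "z \<in> D" for z
    proof -
      have "z \<notin> frontier D" using z D(1) by (simp add: frontier_def interior_open)
      then have pos: "0 < infdist z (frontier D)"
        by (rule infdist_pos_not_in_closed[OF frontier_closed assms(2)])
      have "infdist z (frontier D) * (c1 * c2) = c1 * (c2 * infdist z (frontier D))"
        by (simp add: mult_ac)
      also have "\<dots> \<le> c1 * infdist (f z) (frontier D')"
        using c1 c2(2)[OF z] by (intro mult_left_mono) auto
      also have "\<dots> \<le> infdist z (frontier D) * Lambda f z" by (rule first[OF z])
      finally show ?thesis using pos by simp
    qed
    then show ?thesis using c1 c2(1) by (intro exI[of _ "c1 * c2"]) auto
  qed
  show ?thesis using first second c1 by blast
qed

end
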